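(* Let $\rho:\Gamma'\to\Gamma$ be an immersion of finite connected core graphs and let $\Lambda:S^1\to\Gamma$ be a primitive immersed loop. Let $\mathbb{S}$ be the union of the circular components of the fibre product $\Gamma'\times_\Gamma S^1$ of $\rho$ and $\Lambda$, let $\sigma:\mathbb{S}\to S^1$ be the natural covering map (the restriction of the projection to $S^1$), and let $\Lambda':\mathbb{S}\to\Gamma'$ be the pullback immersion (the restriction of the projection to $\Gamma'$). Suppose that $\mathbb{S}$ is non-empty. Then either \[ \deg\sigma\leq-\chi(\Gamma') \] or $\Lambda':\mathbb{S}\to\Gamma'$ is reducible.
   Context: An immersion of graphs is a locally injective cellular map. A finite connected graph is core if it has no vertices of valence one. If $f_1:\Gamma_1\to\Gamma$ and $f_2:\Gamma_2\to\Gamma$ are immersions of graphs, the fibre product is $\Gamma_1\times_\Gamma\Gamma_2=\{(x,y)\in\Gamma_1\times\Gamma_2\mid f_1(x)=f_2(y)\}$; it is a graph which immerses into $\Gamma_1$ and $\Gamma_2$ via the coordinate projections. (Here $S^1$ carries the graph structure pulled back from $\Gamma$ via $\Lambda$.) A component is circular if it is homeomorphic to a circle. An immersed loop $\Lambda:S^1\to\Gamma$ is primitive if it does not factor properly through any other immersion $S^1\to\Gamma$, i.e. $\Lambda$ is not the composition of a covering map $S^1\to S^1$ of degree greater than one with an immersion $S^1\to\Gamma$. The degree $\deg\sigma$ of a covering map $\sigma$ is the number of preimages of a point. An immersion of a union of circles $\Lambda:\mathbb{S}\to\Gamma$ is reducible if there is an edge of $\Gamma$ which is traversed at most once by $\Lambda$,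 i.e. an edge whose midpoint has at most one preimage in $\mathbb{S}$. $\chi$ denotes Euler characteristic. *)

theory Defs
  imports "Graph_Theory.Bidirected_Digraph" "Graph_Theory.Digraph_Component"
begin

text \<open>
  Graphs are one-dimensional CW complexes, loops and multiple edges allowed. Such a complex is
  represented by \<^term>\<open>bidirected_digraph G r\<close>: every edge of the complex gives two distinct
  arcs \<open>a\<close> and \<open>r a\<close>, namely its two orientations, so the edge itself is the unordered pair
  \<open>{a, r a}\<close>. A point of the complex is a vertex or an interior point of an edge.
  If the domain carries the cell structure pulled back from the target, then a locally injective
  cellular map takes every edge onto an edge and is injective in its interior, so it is a pair of
  maps, on vertices and on arcs, compatible with endpoints and orientation reversal.
\<close>

definition edges :: "('v,'e) pre_digraph \<Rightarrow> ('e \<Rightarrow> 'e) \<Rightarrow> 'e set set" where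
  "edges G r = (\<lambda>a. {a, r a}) ` arcs G"

definition euler_char :: "('v,'e) pre_digraph \<Rightarrow> ('e \<Rightarrow> 'e) \<Rightarrow> int" where
  "euler_char G r = int (card (verts G)) - int (card (edges G r))"

text \<open>
  The valence of \<open>v\<close> is \<^term>\<open>out_degree G v\<close>: a loop contributes both of its orientations,
  hence two.
\<close>

definition core_graph :: "('v,'e) pre_digraph \<Rightarrow> ('e \<Rightarrow> 'e) \<Rightarrow> bool" where
  "core_graph G r \<longleftrightarrow> bidirected_digraph G r \<and> fin_digraph G \<and> connected G \<and>
     (\<forall>v\<in>verts G. out_degree G v \<noteq> 1)"


subsection \<open>Maps of graphs\<close>

record ('v,'e,'w,'d) graph_map =
  vmap :: "'v \<Rightarrow> 'w"
  amap :: "'e \<Rightarrow> 'd"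

definition graph_morphism ::
  "('v,'e) pre_digraph \<Rightarrow> ('e \<Rightarrow> 'e) \<Rightarrow> ('w,'d) pre_digraph \<Rightarrow> ('d \<Rightarrow> 'd) \<Rightarrow>
   ('v,'e,'w,'d) graph_map \<Rightarrow> bool" where
  "graph_morphism G r H s f \<longleftrightarrow>
     (\<forall>v\<in>verts G. vmap f v \<in> verts H) \<and>
     (\<forall>a\<in>arcs G. amap f a \<in> arcs H \<and>
        tail H (amap f a) = vmap f (tail G a) \<and>
        head H (amap f a) = vmap f (head G a) \<and>
        amap f (r a) = s (amap f a))"

text \<open>
  The arcs leaving \<open>v\<close> are the germs of edges at \<open>v\<close>; local injectivity (resp. being a local
  homeomorphism) only has to be tested there.
\<close>

definition immersion ::
  "('v,'e) pre_digraph \<Rightarrow> ('e \<Rightarrow> 'e) \<Rightarrow> ('w,'d) pre_digraph \<Rightarrow> ('d \<Rightarrow> 'd) \<Rightarrow>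
   ('v,'e,'w,'d) graph_map \<Rightarrow> bool" where
  "immersion G r H s f \<longleftrightarrow>
     graph_morphism G r H s f \<and> (\<forall>v\<in>verts G. inj_on (amap f) (out_arcs G v))"

definition covering_map ::
  "('v,'e) pre_digraph \<Rightarrow> ('e \<Rightarrow> 'e) \<Rightarrow> ('w,'d) pre_digraph \<Rightarrow> ('d \<Rightarrow> 'd) \<Rightarrow>
   ('v,'e,'w,'d) graph_map \<Rightarrow> bool" where
  "covering_map G r H s f \<longleftrightarrow>
     graph_morphism G r H s f \<and> vmap f ` verts G = verts H \<and>
     (\<forall>v\<in>verts G. bij_betw (amap f) (out_arcs G v) (out_arcs H (vmap f v)))"

text \<open>
  The degree of a covering map onto a connected graph; the choice of the point does not matter,
  see \<open>covering_degree_eq\<close> below.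
\<close>

definition covering_degree ::
  "('v,'e) pre_digraph \<Rightarrow> ('w,'d) pre_digraph \<Rightarrow> ('v,'e,'w,'d) graph_map \<Rightarrow> nat" where
  "covering_degree G H f = card {v \<in> verts G. vmap f v = (SOME w. w \<in> verts H)}"

definition graph_isomorphism ::
  "('v,'e) pre_digraph \<Rightarrow> ('e \<Rightarrow> 'e) \<Rightarrow> ('w,'d) pre_digraph \<Rightarrow> ('d \<Rightarrow> 'd) \<Rightarrow>
   ('v,'e,'w,'d) graph_map \<Rightarrow> bool" where
  "graph_isomorphism G r H s f \<longleftrightarrow>
     graph_morphism G r H s f \<and>
     bij_betw (vmap f) (verts G) (verts H) \<and> bij_betw (amap f) (arcs G) (arcs H)"


subsection \<open>Circles\<close>

text \<open>
  For \<open>n \<ge> 1\<close>, the circle subdivided into \<open>n\<close> edges. The \<open>i\<close>-th edge joins \<open>i\<close> to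
  \<open>i + 1\<close> modulo \<open>n\<close>; \<open>(i, True)\<close> is its positive and \<open>(i, False)\<close> its negative orientation.
\<close>

definition cycle_graph :: "nat \<Rightarrow> (nat, nat \<times> bool) pre_digraph" where
  "cycle_graph n = \<lparr> verts = {..<n}, arcs = {..<n} \<times> UNIV,
     tail = (\<lambda>(i,b). if b then i else Suc i mod n),
     head = (\<lambda>(i,b). if b then Suc i mod n else i) \<rparr>"

text \<open>\<^const>\<open>bidirected_digraph\<close> requires the reversal to fix everything that is not an arc.\<close>

definition cycle_rev :: "nat \<Rightarrow> nat \<times> bool \<Rightarrow> nat \<times> bool" where
  "cycle_rev n = (\<lambda>(i,b). if i < n then (i, \<not> b) else (i, b))"

text \<open>A graph is homeomorphic to a circle iff it is isomorphic to some \<^term>\<open>cycle_graph m\<close>.\<close>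

definition circular :: "('v,'e) pre_digraph \<Rightarrow> ('e \<Rightarrow> 'e) \<Rightarrow> bool" where
  "circular G r \<longleftrightarrow>
     (\<exists>m\<ge>1. \<exists>h. graph_isomorphism G r (cycle_graph m) (cycle_rev m) h)"

text \<open>
  An immersed loop is an immersion of some \<^term>\<open>cycle_graph n\<close>, which is the graph structure
  on the circle pulled back from the target. If the loop factors through another immersed loop,
  the middle circle carries the pulled back structure as well.
\<close>

definition primitive_loop ::
  "nat \<Rightarrow> ('v,'e) pre_digraph \<Rightarrow> ('e \<Rightarrow> 'e) \<Rightarrow> (nat, nat \<times> bool, 'v, 'e) graph_map \<Rightarrow> bool" where
  "primitive_loop n G r L \<longleftrightarrow>
     immersion (cycle_graph n) (cycle_rev n) G r L \<and>
     \<not> (\<exists>m p K. m \<ge> 1 \<and>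
          covering_map (cycle_graph n) (cycle_rev n) (cycle_graph m) (cycle_rev m) p \<and>
          covering_degree (cycle_graph n) (cycle_graph m) p > 1 \<and>
          immersion (cycle_graph m) (cycle_rev m) G r K \<and>
          (\<forall>v\<in>verts (cycle_graph n). vmap L v = vmap K (vmap p v)) \<and>
          (\<forall>a\<in>arcs (cycle_graph n). amap L a = amap K (amap p a)))"


subsection \<open>Fibre products\<close>

definition fibre_product ::
  "('v,'e) pre_digraph \<Rightarrow> ('v,'e,'u,'c) graph_map \<Rightarrow>
   ('w,'d) pre_digraph \<Rightarrow> ('w,'d,'u,'c) graph_map \<Rightarrow> ('v \<times> 'w, 'e \<times> 'd) pre_digraph" where
  "fibre_product G f H g = \<lparr>
     verts = {(x,y). x \<in> verts G \<and> y \<in> verts H \<and> vmap f x = vmap g y},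
     arcs = {(a,b). a \<in> arcs G \<and> b \<in> arcs H \<and> amap f a = amap g b},
     tail = map_prod (tail G) (tail H),
     head = map_prod (head G) (head H) \<rparr>"

definition fibre_rev ::
  "('v,'e) pre_digraph \<Rightarrow> ('e \<Rightarrow> 'e) \<Rightarrow> ('v,'e,'u,'c) graph_map \<Rightarrow>
   ('w,'d) pre_digraph \<Rightarrow> ('d \<Rightarrow> 'd) \<Rightarrow> ('w,'d,'u,'c) graph_map \<Rightarrow> 'e \<times> 'd \<Rightarrow> 'e \<times> 'd" where
  "fibre_rev G r f H s g =
     (\<lambda>p. if p \<in> arcs (fibre_product G f H g) then map_prod r s p else p)"

definition proj1 :: "('v \<times> 'w, 'e \<times> 'd, 'v, 'e) graph_map" where
  "proj1 = \<lparr> vmap = fst, amap = fst \<rparr>"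

definition proj2 :: "('v \<times> 'w, 'e \<times> 'd, 'w, 'd) graph_map" where
  "proj2 = \<lparr> vmap = snd, amap = snd \<rparr>"

definition components :: "('v,'e) pre_digraph \<Rightarrow> ('v,'e) pre_digraph set" where
  "components G = {C. pre_digraph.max_subgraph G connected C}"

definition circular_part :: "('v,'e) pre_digraph \<Rightarrow> ('e \<Rightarrow> 'e) \<Rightarrow> ('v,'e) pre_digraph" where
  "circular_part G r = pre_digraph.Union G {C \<in> components G. circular C r}"


subsection \<open>Reducibility\<close>

text \<open>
  The preimages of the midpoint of \<open>e\<close> are the midpoints of the edges that \<open>f\<close> maps onto \<open>e\<close>.
\<close>

definition reducible ::
  "('v,'e) pre_digraph \<Rightarrow> ('e \<Rightarrow> 'e) \<Rightarrow> ('w,'d) pre_digraph \<Rightarrow> ('d \<Rightarrow> 'd) \<Rightarrow>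
   ('v,'e,'w,'d) graph_map \<Rightarrow> bool" where
  "reducible S s G r f \<longleftrightarrow>
     (\<exists>e\<in>edges G r. finite {d \<in> edges S s. amap f ` d = e} \<and>
        card {d \<in> edges S s. amap f ` d = e} \<le> 1)"


subsection \<open>Well-definedness\<close>

lemma bidirected_cycle_graph:
  assumes "n \<ge> 1"
  shows "bidirected_digraph (cycle_graph n) (cycle_rev n)"
  using assms
  by unfold_locales (auto simp: cycle_graph_def cycle_rev_def split: if_splits)

lemma bidirected_fibre_product:
  assumes "bidirected_digraph G r" "bidirected_digraph H s"
    and "graph_morphism G r K t f" "graph_morphism H s K t g"
  shows "bidirected_digraph (fibre_product G f H g) (fibre_rev G r f H s g)"
proof -
  interpret G: bidirected_digraph G r by fact
  interpret H: bidirected_digraph H s by fact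
  have "amap f (r a) = amap g (s b)"
    if "a \<in> arcs G" "b \<in> arcs H" "amap f a = amap g b" for a b
    using that assms(3,4) by (simp add: graph_morphism_def)
  moreover have "vmap f (tail G a) = vmap g (tail H b) \<and> vmap f (head G a) = vmap g (head H b)"
    if "a \<in> arcs G" "b \<in> arcs H" "amap f a = amap g b" for a b
    using that assms(3,4) unfolding graph_morphism_def by metis
  ultimately show ?thesis
    by unfold_locales (auto simp: fibre_product_def fibre_rev_def G.arev_neq)
qed

lemma covering_degree_eq:
  assumes cov: "covering_map G r H s f"
    and G: "bidirected_digraph G r" and H: "bidirected_digraph H s"
    and con: "connected H" and w: "w \<in> verts H"
  shows "covering_degree G H f = card {v \<in> verts G. vmap f v = w}"
proof -
  interpret G: bidirected_digraph G r by fact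
  interpret H: bidirected_digraph H s by fact
  let ?F = "\<lambda>w. {v \<in> verts G. vmap f v = w}"
  let ?A = "\<lambda>b. {a \<in> arcs G. amap f a = b}"
  have mor: "graph_morphism G r H s f"
    and bij: "\<And>v. v \<in> verts G \<Longrightarrow> bij_betw (amap f) (out_arcs G v) (out_arcs H (vmap f v))"
    using cov by (auto simp: covering_map_def)
  have 1: "card (?A b) = card (?F (tail H b))" if b: "b \<in> arcs H" for b
  proof (rule bij_betw_same_card[of "tail G"])
    have "inj_on (tail G) (?A b)"
    proof (rule inj_onI)
      fix x y assume xy: "x \<in> ?A b" "y \<in> ?A b" "tail G x = tail G y"
      then show "x = y"
        using bij[of "tail G x"] unfolding bij_betw_def inj_on_def by auto
    qed
    moreover have "tail G ` ?A b = ?F (tail H b)"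
    proof (intro equalityI subsetI)
      fix v assume "v \<in> tail G ` ?A b"
      then show "v \<in> ?F (tail H b)" using mor by (auto simp: graph_morphism_def)
    next
      fix v assume v: "v \<in> ?F (tail H b)"
      then have "b \<in> amap f ` out_arcs G v"
        using bij[of v] b unfolding bij_betw_def by auto
      then show "v \<in> tail G ` ?A b" by auto
    qed
    ultimately show "bij_betw (tail G) (?A b) (?F (tail H b))" by (simp add: bij_betw_def)
  qed
  have 2: "card (?A (s b)) = card (?A b)" if b: "b \<in> arcs H" for b
  proof (rule bij_betw_same_card[of r], rule bij_betwI[where g = r])
    show "r \<in> ?A (s b) \<rightarrow> ?A b" "r \<in> ?A b \<rightarrow> ?A (s b)"
      using mor b by (auto simp: graph_morphism_def)
  qed auto
  have 3: "card (?F u) = card (?F v)" if "u \<rightarrow>\<^bsub>H\<^esub> v" for u v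
    using that
  proof (rule reachableE)
    fix b assume b: "b \<in> arcs H" "tail H b = u" "head H b = v"
    show ?thesis using 1[OF b(1)] 1[of "s b"] 2[OF b(1)] b by simp
  qed
  have 4: "card (?F u) = card (?F v)" if "u \<rightarrow>\<^sup>*\<^bsub>H\<^esub> v" for u v
    using that by (induction rule: H.reachable_induct) (auto simp: 3)
  have "(SOME w. w \<in> verts H) \<in> verts H" using w by (rule someI)
  moreover have "strongly_connected H" using con H.sym_arcs
    by (simp add: connected_def strongly_connected_def H.reachable_mk_symmetric_eq)
  ultimately have "(SOME w. w \<in> verts H) \<rightarrow>\<^sup>*\<^bsub>H\<^esub> w"
    using w by (auto simp: strongly_connected_def)
  then show ?thesis unfolding covering_degree_def by (rule 4)
qed

end

theory Submission
  imports Defs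
begin

text \<open>
  The proof looks at \<open>\<S>\<close> from above. A \<^emph>\<open>stacking\<close> of an immersed graph over \<open>\<Gamma>\<close> is an embedding
  in \<open>\<Gamma> \<times> \<real>\<close> over the immersion: points with the same image get different heights, and so the order
  of two edges over the same edge is the same at both ends.

  A primitive loop \<open>\<Lambda>\<close> has a stacking (\<open>primitive_loop_has_stacking\<close>). If a cocycle on \<open>\<Gamma>\<close> vanishes
  on \<open>\<Lambda>\<close>, then \<open>\<Lambda>\<close> lifts to the infinite cyclic cover of \<open>\<Gamma>\<close> defined by it, and the level in the
  cover is a height that separates some of the points with the same image; heights found in this way
  can be combined lexicographically. Take a height function that separates as many positions as
  possible, and let \<open>\<Lambda>\<close> run in the graph obtained from \<open>\<Gamma>\<close> by separating cells at different heights.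
  Then all cocycles that vanish on \<open>\<Lambda>\<close> are coboundaries. So the traversed graph has first Betti
  number at most one, and since \<open>\<Lambda>\<close> does not backtrack, it is a circle that \<open>\<Lambda>\<close> covers
  (\<open>rigid_imp_covering\<close>). By primitivity the degree of this covering is one, which means that all
  positions with the same image have been separated.

  The heights pull back along \<open>\<sigma>\<close> to a stacking of \<open>\<Lambda>'\<close> (\<open>pullback_stacking\<close>). Suppose that \<open>\<Lambda>'\<close> is
  not reducible. Then every cell of \<open>\<Gamma>'\<close> has exactly one lift to \<open>\<S>\<close> that is visible from above. Both
  edges of \<open>\<S>\<close> at a visible vertex are visible, so the visible part is a union of arcs without their
  end points, and the number of these arcs is the number of edges minus the number of vertices of
  \<open>\<Gamma>'\<close>, that is, \<open>- \<chi>(\<Gamma>')\<close>. All \<open>deg \<sigma>\<close> points of \<open>\<S>\<close> over the highest point of \<open>S\<^sup>1\<close> are visible.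
  They lie on different visible arcs: an arc containing two of them would go once around \<open>S\<^sup>1\<close>, hence
  pass over the lowest point of \<open>S\<^sup>1\<close>, and an edge there would be both highest and lowest among the
  lifts of its image, so this image would be traversed only once. This is \<open>degree_le\<close>; that the
  circular components satisfy its hypotheses holds because the fibre product immerses in \<open>S\<^sup>1\<close> and
  an immersion between graphs of valence two is a covering.
\<close>

section \<open>Loops that lift to no separating cyclic cover\<close>

text \<open>
  An immersed loop of length \<open>n\<close>, remembered only through its labels: \<open>V i\<close> is the vertex at
  position \<open>i\<close>, and \<open>F i\<close>, \<open>B i\<close> are the arc from position \<open>i\<close> to position \<open>i + 1\<close> and its
  reverse. Positions are integers, read modulo \<open>n\<close>. The labels are the cells of the graph that the
  loop traverses, and the axioms say that this graph is well defined (\<open>FF\<close>, \<open>FB\<close>, \<open>BB\<close>), that its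
  reversal fixes no arc (\<open>F_neq_B\<close>), and that the loop does not backtrack (\<open>F_neq_B_pred\<close>).
  Splitting the labels more finely gives a graph through which the loop factors, and this is again
  an instance of the locale.
\<close>

locale immersed_circle =
  fixes n :: int and V :: "int \<Rightarrow> 'a" and F B :: "int \<Rightarrow> 'b"
  assumes n_pos: "n > 0"
    and V_mod: "V (i mod n) = V i" and F_mod: "F (i mod n) = F i" and B_mod: "B (i mod n) = B i"
    and FF: "F i = F j \<Longrightarrow> V i = V j \<and> V (i + 1) = V (j + 1) \<and> B i = B j"
    and FB: "F i = B j \<Longrightarrow> V i = V (j + 1) \<and> V (i + 1) = V j \<and> B i = F j"
    and BB: "B i = B j \<Longrightarrow> F i = F j"
    and F_neq_B: "F i \<noteq> B i"
    and F_neq_B_pred: "F i \<noteq> B (i - 1)"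
begin

lemma BB_iff: "B i = B j \<longleftrightarrow> F i = F j"
  using BB FF by blast

lemma BF_iff: "B i = F j \<longleftrightarrow> F i = B j"
  using FB[of i j] FB[of j i] by metis

text \<open>
  The increments of \<open>p\<close> define a cocycle on the traversed graph which vanishes on the loop, and
  \<open>p\<close> is its primitive along the loop. So \<open>p\<close> is the height of the lift of the loop to the infinite
  cyclic cover given by that cocycle.
\<close>

definition potential :: "(int \<Rightarrow> int) \<Rightarrow> bool" where
  "potential p \<longleftrightarrow> (\<forall>i. p (i mod n) = p i) \<and>
     (\<forall>i j. F i = F j \<longrightarrow> p (i + 1) - p i = p (j + 1) - p j) \<and>
     (\<forall>i j. F i = B j \<longrightarrow> p (i + 1) - p i = p j - p (j + 1))"

text \<open>
  Every cocycle that vanishes on the loop is a coboundary: no infinite cyclic cover to which the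
  loop lifts separates two positions with the same vertex.
\<close>

definition rigid :: bool where
  "rigid \<longleftrightarrow> (\<forall>p i j. potential p \<longrightarrow> V i = V j \<longrightarrow> p i = p j)"

definition first_visits :: "int set" where
  "first_visits = {i \<in> {0..<n}. \<forall>j\<in>{0..<i}. V j \<noteq> V i}"

text \<open>
  The arcs by which the loop reaches a new vertex, with their reverses, form a spanning tree of the
  traversed graph.
\<close>

definition tree_arcs :: "'b set" where
  "tree_arcs = F ` ((\<lambda>i. i - 1) ` (first_visits - {0})) \<union> B ` ((\<lambda>i. i - 1) ` (first_visits - {0}))"

lemma first_visit_exists: "\<exists>j\<in>first_visits. V j = V i"
proof -
  define S where "S = {j \<in> {0..<n}. V j = V i}"
  have "i mod n \<in> S" using n_pos V_mod by (auto simp: S_def)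
  moreover have "S \<subseteq> {0..<n}" by (auto simp: S_def)
  then have "finite S" by (rule finite_subset) simp
  ultimately have m: "Min S \<in> S" "\<And>j. j \<in> S \<Longrightarrow> Min S \<le> j" by (auto intro: Min_in)
  have "V k \<noteq> V (Min S)" if "k \<in> {0..<Min S}" for k
  proof
    assume "V k = V (Min S)"
    then have "k \<in> S" using that m(1) by (auto simp: S_def)
    then show False using m(2) that by fastforce
  qed
  moreover have "Min S \<in> {0..<n}" "V (Min S) = V i" using m(1) unfolding S_def by blast+
  ultimately show ?thesis unfolding first_visits_def by blast
qed

lemma first_visits_inj: "i \<in> first_visits \<Longrightarrow> j \<in> first_visits \<Longrightarrow> V i = V j \<Longrightarrow> i = j"
  unfolding first_visits_def by (cases i j rule: linorder_cases) auto

lemma sum_potential: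
  assumes q_mod: "\<And>i. q (i mod n) = q i" and sum0: "(\<Sum>k\<in>{0..<n}. q k) = 0"
  obtains p :: "int \<Rightarrow> int" where "p 0 = 0" "\<And>i. p (i mod n) = p i" "\<And>i. p (i + 1) - p i = q i"
proof
  define p where "p i = (\<Sum>k\<in>{0..<i mod n}. q k)" for i
  show "p 0 = 0" "p (i mod n) = p i" for i by (simp_all add: p_def)
  show "p (i + 1) - p i = q i" for i
  proof -
    have r: "0 \<le> i mod n" "i mod n < n" using n_pos by auto
    then have "{0..<i mod n + 1} = insert (i mod n) {0..<i mod n}" by auto
    then have s: "(\<Sum>k\<in>{0..<i mod n + 1}. q k) = q i + p i" by (simp add: p_def q_mod)
    show ?thesis
    proof (cases "i mod n + 1 = n")
      case True
      then have "(i + 1) mod n = 0" by (metis mod_add_left_eq mod_self)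
      then have "p (i + 1) = 0" by (simp add: p_def)
      then show ?thesis using s sum0 True by simp
    next
      case False
      then have "(i + 1) mod n = i mod n + 1" using r
        by (smt (verit) mod_add_left_eq mod_pos_pos_trivial)
      then show ?thesis using s by (simp add: p_def)
    qed
  qed
qed

text \<open>
  The cocycle dual to the edge \<open>F i\<close>, evaluated on \<open>F k\<close>.
\<close>

definition crossing :: "int \<Rightarrow> int \<Rightarrow> int" where
  "crossing i k = (if F k = F i then 1 else if F k = B i then - 1 else 0)"

lemma crossing_mod: "crossing i (k mod n) = crossing i k"
  by (simp add: crossing_def F_mod)

lemma crossing_FB: "F k = B l \<Longrightarrow> crossing i k = - crossing i l"
proof -
  assume kl: "F k = B l"
  have "F k = F i \<longleftrightarrow> F l = B i" "F k = B i \<longleftrightarrow> F l = F i"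
    unfolding kl by (rule BF_iff, rule BB_iff)
  moreover have "F i \<noteq> B i" by (rule F_neq_B)
  ultimately show ?thesis unfolding crossing_def by simp
qed

lemma crossing_tree:
  assumes "F i \<notin> tree_arcs" "m \<in> first_visits" "m \<noteq> 0"
  shows "crossing i (m - 1) = 0"
proof -
  have "F (m - 1) \<in> tree_arcs" "B (m - 1) \<in> tree_arcs" using assms by (auto simp: tree_arcs_def)
  then have "F (m - 1) \<noteq> F i" "F (m - 1) \<noteq> B i" using assms(1) BF_iff by metis+
  then show ?thesis by (simp add: crossing_def)
qed

text \<open>
  The primitive of a cocycle supported off the tree does not change when the loop reaches a new
  vertex, and by rigidity it repeats its old value when the loop returns to a vertex. So it is zero
  all the time, and with it the cocycle.
\<close>

lemma off_tree_flow_zero: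
  assumes rigid: rigid
    and e: "F i \<notin> tree_arcs" "F j \<notin> tree_arcs"
    and sum0: "(\<Sum>k\<in>{0..<n}. x * crossing i k + y * crossing j k) = 0"
  shows "x * crossing i m + y * crossing j m = 0"
proof -
  define q where "q k = x * crossing i k + y * crossing j k" for k
  have q_mod: "q (k mod n) = q k" for k by (simp add: q_def crossing_mod)
  obtain p where p: "p 0 = 0" "\<And>i. p (i mod n) = p i" "\<And>i. p (i + 1) - p i = q i"
    using sum_potential[of q] q_mod sum0 unfolding q_def by blast
  have pot: "potential p"
    unfolding potential_def
  proof (intro conjI allI impI)
    fix k l assume "F k = B l"
    then have "q k = - q l" using crossing_FB by (simp add: q_def)
    then show "p (k + 1) - p k = p l - p (l + 1)" using p(3)[of k] p(3)[of l] by linarith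
  next
    fix k l assume "F k = F l"
    then have "q k = q l" by (simp add: q_def crossing_def)
    then show "p (k + 1) - p k = p (l + 1) - p l" by (simp add: p(3))
  qed (rule p(2))
  have zero: "0 \<le> k \<Longrightarrow> k < n \<Longrightarrow> p k = 0" for k
  proof (induction "nat k" arbitrary: k rule: less_induct)
    case less
    show ?case
    proof (cases "k \<in> first_visits")
      case True
      show ?thesis
      proof (cases "k = 0")
        case False
        then have "p (k - 1) = 0" using less.hyps[of "k - 1"] less.prems by auto
        moreover have "q (k - 1) = 0" using crossing_tree e True False by (simp add: q_def)
        ultimately show ?thesis using p(3)[of "k - 1"] by simp
      qed (simp add: p)
    next
      case False
      then obtain l where "0 \<le> l" "l < k" "V l = V k"
        using less.prems by (auto simp: first_visits_def)
      moreover from this have "p l = p k" using rigid pot unfolding rigid_def by blast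
      ultimately show ?thesis using less.hyps[of l] less.prems by simp
    qed
  qed
  have "p k = 0" for k using zero[of "k mod n"] n_pos p(2) by simp
  then show ?thesis using p(3)[of m] by (simp add: q_def)
qed

text \<open>
  Two different edges off the tree would span a plane of cocycles. Some nonzero one of them
  vanishes on the loop, which contradicts the previous lemma. Hence a rigid loop traverses a graph of
  first Betti number at most one.
\<close>

lemma off_tree_unique:
  assumes rigid: rigid
    and e: "F i \<notin> tree_arcs" "F j \<notin> tree_arcs"
  shows "F j = F i \<or> F j = B i"
proof (rule ccontr)
  assume neq: "\<not> ?thesis"
  define c where "c i = (\<Sum>k\<in>{0..<n}. crossing i k)" for i
  have self: "crossing i i = 1" "crossing j j = 1" by (simp_all add: crossing_def)
  have off: "crossing i j = 0" "crossing j i = 0" using neq BF_iff[of i j] by (auto simp: crossing_def)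
  have sum: "(\<Sum>k\<in>{0..<n}. x * crossing i k + y * crossing j k) = x * c i + y * c j" for x y
    by (simp add: c_def sum.distrib sum_distrib_left)
  note flow = off_tree_flow_zero[OF rigid e, unfolded sum]
  \<comment> \<open>These coefficients make the combination vanish on the loop; if both are zero, the first edge
    alone already does.\<close>
  have "c j = 0" "c i = 0"
    using flow[of "c j" "- c i" i] flow[of "c j" "- c i" j] self off by (simp_all add: algebra_simps)
  then show False using flow[of 1 0 i] self by simp
qed

text \<open>
  A connected graph of first Betti number at most one has at most as many edges as vertices. Labels
  count oriented edges, hence the factor two.
\<close>

lemma card_labels_le:
  assumes rigid: rigid
  shows "finite (range F \<union> range B)" "card (range F \<union> range B) \<le> 2 * card first_visits"
proof -
  have "first_visits \<subseteq> {0..<n}" by (auto simp: first_visits_def)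
  then have fin: "finite first_visits" by (rule finite_subset) simp
  have "0 \<in> first_visits" using n_pos by (auto simp: first_visits_def)
  then have fv: "card first_visits = Suc (card (first_visits - {0}))"
    using fin by (simp only: card_Suc_Diff1)
  have t: "card tree_arcs \<le> 2 * card (first_visits - {0})" "finite tree_arcs"
  proof -
    let ?X = "(\<lambda>i. i - 1) ` (first_visits - {0})"
    have X: "finite ?X" "card ?X \<le> card (first_visits - {0})" using fin by (auto intro: card_image_le)
    have "card tree_arcs \<le> card (F ` ?X) + card (B ` ?X)"
      unfolding tree_arcs_def by (rule card_Un_le)
    also have "\<dots> \<le> 2 * card ?X" using card_image_le[OF X(1), of F] card_image_le[OF X(1), of B] by linarith
    finally show "card tree_arcs \<le> 2 * card (first_visits - {0})" using X by linarith
    show "finite tree_arcs" using X unfolding tree_arcs_def by auto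
  qed
  have rev: "B i \<in> tree_arcs \<longleftrightarrow> F i \<in> tree_arcs" for i
  proof -
    let ?X = "(\<lambda>i. i - 1) ` (first_visits - {0})"
    have "F i \<in> tree_arcs \<longleftrightarrow> (\<exists>k\<in>?X. F i = F k \<or> F i = B k)"
      "B i \<in> tree_arcs \<longleftrightarrow> (\<exists>k\<in>?X. B i = F k \<or> B i = B k)" unfolding tree_arcs_def by blast+
    then show ?thesis by (auto simp: BB_iff BF_iff)
  qed
  have "\<exists>e. range F \<union> range B \<subseteq> tree_arcs \<union> {F e, B e}"
  proof (cases "\<exists>e. F e \<notin> tree_arcs")
    case True
    then obtain e where e: "F e \<notin> tree_arcs" by auto
    have "F i \<in> tree_arcs \<union> {F e, B e} \<and> B i \<in> tree_arcs \<union> {F e, B e}" for i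
      using off_tree_unique[OF rigid e, of i] rev[of i] BB_iff[of i e] BF_iff[of i e] by auto
    then show ?thesis by blast
  qed (use rev in auto)
  then obtain e where e: "range F \<union> range B \<subseteq> tree_arcs \<union> {F e, B e}" by auto
  have f2: "finite (tree_arcs \<union> {F e, B e})" using t(2) by simp
  show "finite (range F \<union> range B)" using finite_subset[OF e f2] .
  have "card (range F \<union> range B) \<le> card (tree_arcs \<union> {F e, B e})" by (rule card_mono[OF f2 e])
  also have "\<dots> \<le> card tree_arcs + card {F e, B e}" by (rule card_Un_le)
  also have "\<dots> \<le> 2 * card first_visits"
    using t(1) fv card_insert_le_m1[of 2 "{B e}" "F e"] by simp
  finally show "card (range F \<union> range B) \<le> 2 * card first_visits" .
qed

text \<open>
  Since the loop does not backtrack, every vertex has at least the two outgoing arcs found at its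
  first visit. By the bound on the number of arcs there are no others.
\<close>

lemma valence_two:
  assumes rigid: rigid
    and "V i = V j"
  shows "{F i, B (i - 1)} = {F j, B (j - 1)}"
proof -
  define out where "out = (\<lambda>(i, b). if b then F i else B (i - 1))"
  have out_V: "V i = V j" if "out (i, b) = out (j, c)" for i j b c
  proof (cases b; cases c)
    assume "b" "c"
    then show ?thesis using that FF[of i j] by (simp add: out_def)
  next
    assume "b" "\<not> c"
    then have "F i = B (j - 1)" using that by (simp add: out_def)
    from FB[OF this] show ?thesis by simp
  next
    assume "\<not> b" "c"
    then have "F j = B (i - 1)" using that by (simp add: out_def)
    from FB[OF this] show ?thesis by simp
  next
    assume "\<not> b" "\<not> c"
    then have "F (i - 1) = F (j - 1)" using that BB_iff by (simp add: out_def)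
    from FF[OF this] show ?thesis by simp
  qed
  have inj: "inj_on out (first_visits \<times> UNIV)"
  proof (rule inj_onI, clarify)
    fix i j b c assume a: "i \<in> first_visits" "j \<in> first_visits" "out (i, b) = out (j, c)"
    then have "i = j" using out_V first_visits_inj by blast
    then show "i = j \<and> b = c" using a(3) F_neq_B_pred[of j] by (auto simp: out_def split: if_splits)
  qed
  have sub: "out ` (first_visits \<times> UNIV) \<subseteq> range F \<union> range B" by (auto simp: out_def)
  have "card (out ` (first_visits \<times> UNIV)) = 2 * card first_visits"
    using inj by (simp add: card_image card_cartesian_product)
  then have all: "out ` (first_visits \<times> UNIV) = range F \<union> range B"
    using card_labels_le[OF rigid] sub by (metis card_seteq)
  have at_first: "{F k, B (k - 1)} = {F m, B (m - 1)}" if m: "m \<in> first_visits" "V m = V k" for k m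
  proof -
    have "\<exists>c. out (k, b) = out (m, c)" for b
    proof -
      have "out (k, b) \<in> range F \<union> range B" by (auto simp: out_def)
      then obtain m' c where m': "m' \<in> first_visits" "out (k, b) = out (m', c)"
        unfolding all[symmetric] by auto
      then have "m' = m" using out_V[of k b m' c] m first_visits_inj by metis
      then show ?thesis using m' by blast
    qed
    from this[of True] this[of False] show ?thesis
      using F_neq_B_pred[of k] by (auto simp: out_def split: if_splits)
  qed
  obtain m where "m \<in> first_visits" "V m = V i" using first_visit_exists by blast
  then show ?thesis using at_first[of m i] at_first[of m j] assms(2) by simp
qed

text \<open>
  As all valences are two, the loop runs around a circle. If it passed the same vertex in the
  opposite direction, the two passages could be followed, one forwards and one backwards, until they
  meet halfway between \<open>i\<close> and \<open>j\<close>; there the loop would backtrack at a vertex or reverse inside an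
  edge.
\<close>

lemma rigid_imp_covering:
  assumes rigid: rigid
    and ij: "V i = V j"
  shows "F i = F j"
proof (rule ccontr)
  assume "F i \<noteq> F j"
  then have start: "F i = B (j - 1)" using valence_two[OF rigid ij] unfolding doubleton_eq_iff by blast
  have flip: "F (i + int t) = B (j - 1 - int t)" for t
  proof (induction t)
    case (Suc t)
    let ?i = "i + int t" and ?j = "j - 1 - int t"
    have v: "V (?i + 1) = V ?j" "B ?i = F ?j" using FB[OF Suc] by simp_all
    then have "{F (?i + 1), B ?i} = {F ?j, B (?j - 1)}" using valence_two[OF rigid v(1)] by simp
    moreover have "F (?i + 1) \<noteq> F ?j" using F_neq_B_pred[of "?i + 1"] v(2) by simp
    ultimately have "F (?i + 1) = B (?j - 1)" unfolding doubleton_eq_iff by blast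
    then show ?case by (simp add: algebra_simps)
  qed (simp add: start)
  define d where "d = (j - i) mod n"
  have d: "d \<ge> 0" "(i + d) mod n = j mod n" using n_pos by (auto simp: d_def mod_add_right_eq)
  show False
  proof (cases "even d")
    case True
    then obtain k where k: "d = 2 * k" by (auto elim: evenE)
    then have "(j - 1 - k) mod n = (i + k - 1) mod n"
      using mod_diff_cong[OF d(2)[symmetric] refl, of "1 + k"] by (simp add: algebra_simps)
    then have "B (j - 1 - k) = B (i + k - 1)" using B_mod by metis
    then show False using flip[of "nat k"] F_neq_B_pred[of "i + k"] d k by simp
  next
    case False
    then obtain k where k: "d = 2 * k + 1" by (auto elim: oddE)
    then have "(j - 1 - k) mod n = (i + d - 1 - k) mod n" using mod_diff_cong[OF d(2)[symmetric] refl, of "1 + k"] by (simp add: algebra_simps)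
    then have "(j - 1 - k) mod n = (i + k) mod n" by (simp add: k add.commute)
    then have "B (j - 1 - k) = B (i + k)" using B_mod by metis
    then show False using flip[of "nat k"] F_neq_B[of "i + k"] d k by simp
  qed
qed

end

subsection \<open>Height functions that separate as much as possible\<close>

lemma sgn_lexicographic:
  fixes M x y :: int
  assumes "\<bar>y\<bar> < M"
  shows "sgn (M * x + y) = (if x = 0 then sgn y else sgn x)"
proof (cases x "0 :: int" rule: linorder_cases)
  case less
  then have "M * x \<le> M * (- 1)" using assms by (intro mult_left_mono) auto
  then have "M * x + y < 0" using assms by linarith
  then show ?thesis using less by simp
next
  case greater
  then have "M * 1 \<le> M * x" using assms by (intro mult_left_mono) auto
  then have "M * x + y > 0" using assms by linarith
  then show ?thesis using greater by simp
qed simp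

context immersed_circle
begin

text \<open>
  A height function for which the order of two passages along the same edge does not change between
  its ends, although they may still have the same height.
\<close>

definition pre_stacking :: "(int \<Rightarrow> int) \<Rightarrow> bool" where
  "pre_stacking h \<longleftrightarrow> (\<forall>i. h (i mod n) = h i) \<and>
     (\<forall>i j. F i = F j \<longrightarrow> sgn (h i - h j) = sgn (h (i + 1) - h (j + 1))) \<and>
     (\<forall>i j. F i = B j \<longrightarrow> sgn (h i - h (j + 1)) = sgn (h (i + 1) - h j))"

lemma pre_stackingD:
  assumes "pre_stacking h"
  shows "h (i mod n) = h i"
    and "F i = F j \<Longrightarrow> sgn (h i - h j) = sgn (h (i + 1) - h (j + 1))"
    and "F i = B j \<Longrightarrow> sgn (h i - h (j + 1)) = sgn (h (i + 1) - h j)"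
  using assms unfolding pre_stacking_def by blast+

lemma pre_stackingD_eq:
  assumes "pre_stacking h"
  shows "F i = F j \<Longrightarrow> h i = h j \<longleftrightarrow> h (i + 1) = h (j + 1)"
    and "F i = B j \<Longrightarrow> h i = h (j + 1) \<longleftrightarrow> h (i + 1) = h j"
proof -
  have sgn_imp: "sgn x = sgn y \<Longrightarrow> x = 0 \<longleftrightarrow> y = 0" for x y :: int using sgn_eq_0_iff[of x] sgn_eq_0_iff[of y] by argo
  show "h i = h j \<longleftrightarrow> h (i + 1) = h (j + 1)" if "F i = F j"
    using sgn_imp[OF pre_stackingD(2)[OF assms that]] by simp
  show "h i = h (j + 1) \<longleftrightarrow> h (i + 1) = h j" if "F i = B j"
    using sgn_imp[OF pre_stackingD(3)[OF assms that]] by simp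
qed

text \<open>
  Passages at different heights count as different cells of the traversed graph. Edges stay well
  defined, because two passages along an edge agree in height at one end iff they do at the other.
\<close>

lemma refinement:
  assumes "pre_stacking h"
  shows "immersed_circle n (\<lambda>i. (V i, h i)) (\<lambda>i. (F i, h i)) (\<lambda>i. (B i, h (i + 1)))"
proof
  show "n > 0" by (rule n_pos)
  fix i j
  have h_mod: "h (k mod n) = h k" for k using pre_stackingD(1)[OF assms] .
  have "h (i mod n + 1) = h (i + 1)" using h_mod[of "i mod n + 1"] h_mod[of "i + 1"] by (simp add: mod_add_left_eq)
  then show "(V (i mod n), h (i mod n)) = (V i, h i)" "(F (i mod n), h (i mod n)) = (F i, h i)"
    "(B (i mod n), h (i mod n + 1)) = (B i, h (i + 1))" by (simp_all add: V_mod F_mod B_mod h_mod)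
  show "(V i, h i) = (V j, h j) \<and> (V (i + 1), h (i + 1)) = (V (j + 1), h (j + 1)) \<and>
      (B i, h (i + 1)) = (B j, h (j + 1))" if "(F i, h i) = (F j, h j)"
    using that FF[of i j] pre_stackingD_eq(1)[OF assms, of i j] by simp
  show "(V i, h i) = (V (j + 1), h (j + 1)) \<and> (V (i + 1), h (i + 1)) = (V j, h j) \<and>
      (B i, h (i + 1)) = (F j, h j)" if "(F i, h i) = (B j, h (j + 1))"
    using that FB[of i j] pre_stackingD_eq(2)[OF assms, of i j] by simp
  show "(F i, h i) = (F j, h j)" if "(B i, h (i + 1)) = (B j, h (j + 1))"
    using that BB_iff[of i j] pre_stackingD_eq(1)[OF assms, of i j] by simp
  show "(F i, h i) \<noteq> (B i, h (i + 1))" using F_neq_B by simp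
  show "(F i, h i) \<noteq> (B (i - 1), h (i - 1 + 1))" using F_neq_B_pred by simp
qed

text \<open>
  Ties in \<open>h\<close> are broken by \<open>p\<close>. The lexicographic order of the pairs \<open>(h i, p i)\<close> is encoded as
  the order of the integers \<open>M * h i + p i\<close> with \<open>M\<close> large; \<open>p\<close> is consistent on the passages that \<open>h\<close>
  does not separate, and this is exactly where it is consulted.
\<close>

lemma refine_pre_stacking:
  assumes h: "pre_stacking h"
    and p: "immersed_circle.potential n (\<lambda>i. (F i, h i)) (\<lambda>i. (B i, h (i + 1))) p"
  obtains h' where "pre_stacking h'" "\<And>i j. h' i = h' j \<Longrightarrow> h i = h j \<and> p i = p j"
proof -
  interpret R: immersed_circle n "\<lambda>i. (V i, h i)" "\<lambda>i. (F i, h i)" "\<lambda>i. (B i, h (i + 1))"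
    by (rule refinement[OF h])
  have p_mod: "p (i mod n) = p i" and pF: "F i = F j \<Longrightarrow> h i = h j \<Longrightarrow> p (i + 1) - p i = p (j + 1) - p j"
    and pB: "F i = B j \<Longrightarrow> h i = h (j + 1) \<Longrightarrow> p (i + 1) - p i = p j - p (j + 1)" for i j
    using p unfolding R.potential_def by blast+
  define K where "K = Max ((\<lambda>i. \<bar>p i\<bar>) ` {0..<n})"
  have K: "\<bar>p i\<bar> \<le> K" for i
  proof -
    have "\<bar>p (i mod n)\<bar> \<le> K" unfolding K_def using n_pos by (intro Max_ge) auto
    then show ?thesis by (simp add: p_mod)
  qed
  define M where "M = 2 * K + 1"
  have bound: "\<bar>p i - p j\<bar> < M" for i j using K[of i] K[of j] unfolding M_def by linarith
  define h' where "h' i = M * h i + p i" for i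
  have sgn': "sgn (h' i - h' j) = (if h i = h j then sgn (p i - p j) else sgn (h i - h j))" for i j
    using sgn_lexicographic[OF bound[of i j], of "h i - h j"] by (simp add: h'_def algebra_simps)
  show thesis
  proof
    show "h i = h j \<and> p i = p j" if "h' i = h' j" for i j
      using sgn'[of i j] that by (auto simp: sgn_0_0 split: if_splits)
    show "pre_stacking h'"
      unfolding pre_stacking_def
    proof (intro conjI allI impI)
      show "h' (i mod n) = h' i" for i using p_mod pre_stackingD(1)[OF h] by (simp add: h'_def)
    next
      fix i j assume e: "F i = F j"
      show "sgn (h' i - h' j) = sgn (h' (i + 1) - h' (j + 1))"
      proof (cases "h i = h j")
        case True
        then have "p i - p j = p (i + 1) - p (j + 1)" using pF[OF e] by simp
        then show ?thesis unfolding sgn' using True pre_stackingD_eq(1)[OF h e] by simp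
      qed (use pre_stackingD_eq(1)[OF h e] pre_stackingD(2)[OF h e] in \<open>simp add: sgn'\<close>)
    next
      fix i j assume e: "F i = B j"
      show "sgn (h' i - h' (j + 1)) = sgn (h' (i + 1) - h' j)"
      proof (cases "h i = h (j + 1)")
        case True
        then have "p i - p (j + 1) = p (i + 1) - p j" using pB[OF e] by simp
        then show ?thesis unfolding sgn' using True pre_stackingD_eq(2)[OF h e] by simp
      qed (use pre_stackingD_eq(2)[OF h e] pre_stackingD(3)[OF h e] in \<open>simp add: sgn'\<close>)
    qed
  qed
qed

text \<open>
  A height function that separates as many positions as possible leaves a rigid loop, because any
  potential that is not constant on the remaining classes would separate more. So the loop covers a
  circle, and the distance of two unseparated positions is a period of the loop.
\<close>

lemma stacking_exists:
  assumes primitive: "\<And>d. (\<And>i. F (i + d) = F i) \<Longrightarrow> n dvd d"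
  obtains h where "pre_stacking h" "\<And>i j. V i = V j \<Longrightarrow> h i = h j \<Longrightarrow> n dvd i - j"
proof -
  define P where "P h = {(i, j). i \<in> {0..<n} \<and> j \<in> {0..<n} \<and> V i = V j \<and> h i = h j}" for h :: "int \<Rightarrow> int"
  have finP: "finite (P h)" for h
    by (rule finite_subset[of _ "{0..<n} \<times> {0..<n}"]) (auto simp: P_def)
  have "pre_stacking (\<lambda>_. 0)" by (simp add: pre_stacking_def)
  then obtain h where h: "pre_stacking h" and min: "\<And>h'. pre_stacking h' \<Longrightarrow> card (P h) \<le> card (P h')"
    using ex_has_least_nat[of pre_stacking _ "\<lambda>h. card (P h)"] by blast
  interpret R: immersed_circle n "\<lambda>i. (V i, h i)" "\<lambda>i. (F i, h i)" "\<lambda>i. (B i, h (i + 1))"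
    by (rule refinement[OF h])
  have rigid: "R.rigid"
    unfolding R.rigid_def
  proof (intro allI impI, rule ccontr)
    fix p i j assume p: "R.potential p" and ij: "(V i, h i) = (V j, h j)" and neq: "p i \<noteq> p j"
    obtain h' where h': "pre_stacking h'" "\<And>i j. h' i = h' j \<Longrightarrow> h i = h j \<and> p i = p j"
      using refine_pre_stacking[OF h p] by blast
    have "p k = p (k mod n)" for k using p unfolding R.potential_def by simp
    then have "p (i mod n) \<noteq> p (j mod n)" using neq by metis
    then have "(i mod n, j mod n) \<notin> P h'" using h'(2) unfolding P_def by blast
    moreover have "(i mod n, j mod n) \<in> P h"
      using ij n_pos by (simp add: P_def V_mod pre_stackingD(1)[OF h])
    moreover have "P h' \<subseteq> P h" using h'(2) unfolding P_def by blast
    ultimately have "card (P h') < card (P h)" using psubset_card_mono[OF finP] by blast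
    then show False using min[OF h'(1)] by simp
  qed
  have "n dvd i - j" if ij: "V i = V j" "h i = h j" for i j
  proof (rule primitive)
    have shift: "F (i + int t) = F (j + int t) \<and> h (i + int t) = h (j + int t)" for t
    proof (induction t)
      case 0
      then show ?case using R.rigid_imp_covering[OF rigid, of i j] ij by simp
    next
      case (Suc t)
      then have "V (i + int t + 1) = V (j + int t + 1)" "h (i + int t + 1) = h (j + int t + 1)"
        using R.FF[of "i + int t" "j + int t"] by simp_all
      then show ?case using R.rigid_imp_covering[OF rigid, of "i + int t + 1" "j + int t + 1"]
        by (simp add: algebra_simps)
    qed
    fix k
    define t where "t = nat ((k - j) mod n)"
    have "(j + int t) mod n = k mod n" using n_pos by (simp add: t_def mod_add_right_eq)
    moreover have "(i + int t) mod n = (k + (i - j)) mod n"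
      using mod_add_cong[OF \<open>(j + int t) mod n = k mod n\<close> refl, of "i - j"] by (simp add: algebra_simps)
    ultimately show "F (k + (i - j)) = F k" using shift[of t] F_mod by metis
  qed
  then show thesis using that h by blast
qed

end

section \<open>Stackings of primitive loops\<close>

text \<open>
  For an immersion \<open>f\<close>, the heights \<open>h\<close> on the vertices and affine interpolation on the edges embed
  \<open>S\<close> in the product of the target of \<open>f\<close> with the real line, over \<open>f\<close>: different points with the same image have
  different heights. For edges it is enough to require that their order is the same at both ends.
\<close>

definition stacking ::
  "('v,'e) pre_digraph \<Rightarrow> ('v,'e,'w,'d) graph_map \<Rightarrow> ('v \<Rightarrow> int) \<Rightarrow> bool" where
  "stacking S f h \<longleftrightarrow>
     inj_on (\<lambda>v. (vmap f v, h v)) (verts S) \<and>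
     (\<forall>a\<in>arcs S. \<forall>b\<in>arcs S. amap f a = amap f b \<longrightarrow>
        (h (tail S a) < h (tail S b) \<longleftrightarrow> h (head S a) < h (head S b)))"

lemma cycle_graph_simps [simp]:
  "verts (cycle_graph n) = {..<n}"
  "arcs (cycle_graph n) = {..<n} \<times> UNIV"
  "tail (cycle_graph n) (i, b) = (if b then i else Suc i mod n)"
  "head (cycle_graph n) (i, b) = (if b then Suc i mod n else i)"
  by (simp_all add: cycle_graph_def)

lemma Suc_nat_mod:
  assumes "n \<ge> 1"
  shows "Suc (nat (i mod int n)) mod n = nat ((i + 1) mod int n)"
proof -
  have "int (Suc (nat (i mod int n)) mod n) = (i mod int n + 1) mod int n"
    using assms by (simp add: zmod_int add.commute)
  also have "\<dots> = int (nat ((i + 1) mod int n))" using assms by (simp add: mod_add_left_eq)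
  finally show ?thesis by (simp only: of_nat_eq_iff)
qed

lemma loop_arcs:
  assumes "graph_morphism (cycle_graph n) (cycle_rev n) G r L" and "x < n"
  shows "amap L (x, b) \<in> arcs G"
    and "tail G (amap L (x, b)) = vmap L (if b then x else Suc x mod n)"
    and "head G (amap L (x, b)) = vmap L (if b then Suc x mod n else x)"
    and "amap L (x, False) = r (amap L (x, True))"
    and "amap L (x, True) = r (amap L (x, False))"
proof -
  have arc: "(x, c) \<in> arcs (cycle_graph n)" for c using assms(2) by simp
  note * = assms(1)[unfolded graph_morphism_def, THEN conjunct2, rule_format, OF arc]
  show "amap L (x, b) \<in> arcs G" "tail G (amap L (x, b)) = vmap L (if b then x else Suc x mod n)"
    "head G (amap L (x, b)) = vmap L (if b then Suc x mod n else x)"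
    using *[of b] by (cases b; simp)+
  show "amap L (x, False) = r (amap L (x, True))" "amap L (x, True) = r (amap L (x, False))"
    using *[of True] *[of False] assms(2) by (simp_all add: cycle_rev_def)
qed

lemma out_arcs_cycle_graph:
  assumes "v < n"
  shows "out_arcs (cycle_graph n) v = {(v, True), ((v + n - 1) mod n, False)}"
proof -
  have pred: "Suc i mod n = v \<longleftrightarrow> i = (v + n - 1) mod n" if "i < n" for i
  proof
    assume "Suc i mod n = v"
    then have "(v + n - 1) mod n = (Suc i mod n + (n - 1)) mod n" using that by simp
    also have "\<dots> = (Suc i + (n - 1)) mod n" by (rule mod_add_left_eq)
    also have "Suc i + (n - 1) = i + n" using that by simp
    finally show "i = (v + n - 1) mod n" using that by simp
  next
    assume "i = (v + n - 1) mod n"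
    then have "Suc i mod n = Suc (v + n - 1) mod n" by (simp add: mod_Suc_eq)
    then show "Suc i mod n = v" using assms by simp
  qed
  show ?thesis
  proof (rule set_eqI)
    fix a :: "nat \<times> bool"
    obtain i b where a: "a = (i, b)" by (cases a)
    show "a \<in> out_arcs (cycle_graph n) v \<longleftrightarrow> a \<in> {(v, True), ((v + n - 1) mod n, False)}"
      unfolding a using pred[of i] assms by (cases b) auto
  qed
qed

text \<open>
  Reading an immersion of \<open>cycle_graph n\<close> along the positive direction gives labels of the kind
  considered above.
\<close>

lemma loop_immersed_circle:
  assumes G: "bidirected_digraph G r" and n: "n \<ge> 1"
    and L: "immersion (cycle_graph n) (cycle_rev n) G r L"
  shows "immersed_circle (int n) (\<lambda>i. vmap L (nat (i mod int n)))
           (\<lambda>i. amap L (nat (i mod int n), True)) (\<lambda>i. amap L (nat (i mod int n), False))"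
proof -
  interpret G: bidirected_digraph G r by (rule G)
  define pos where "pos i = nat (i mod int n)" for i
  have pos: "pos i < n" for i using n by (simp add: pos_def nat_less_iff)
  have Suc_pos: "Suc (pos i) mod n = pos (i + 1)" for i
    unfolding pos_def by (rule Suc_nat_mod[OF n])
  have mor: "graph_morphism (cycle_graph n) (cycle_rev n) G r L" using L by (simp add: immersion_def)
  have arc: "amap L (pos i, True) \<in> arcs G" "tail G (amap L (pos i, True)) = vmap L (pos i)"
      "head G (amap L (pos i, True)) = vmap L (pos (i + 1))"
      "amap L (pos i, False) = r (amap L (pos i, True))" for i
    using loop_arcs[OF mor pos[of i]] by (simp_all add: Suc_pos)
  have "immersed_circle (int n) (\<lambda>i. vmap L (pos i)) (\<lambda>i. amap L (pos i, True)) (\<lambda>i. amap L (pos i, False))"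
  proof
    show "int n > 0" using n by simp
    fix i j
    have "pos (i mod int n) = pos i" by (simp add: pos_def)
    then show "vmap L (pos (i mod int n)) = vmap L (pos i)"
      "amap L (pos (i mod int n), True) = amap L (pos i, True)"
      "amap L (pos (i mod int n), False) = amap L (pos i, False)" by simp_all
    show "vmap L (pos i) = vmap L (pos j) \<and> vmap L (pos (i + 1)) = vmap L (pos (j + 1)) \<and>
        amap L (pos i, False) = amap L (pos j, False)"
      if "amap L (pos i, True) = amap L (pos j, True)"
      using arc[of i] arc[of j] that by simp
    show "vmap L (pos i) = vmap L (pos (j + 1)) \<and> vmap L (pos (i + 1)) = vmap L (pos j) \<and>
        amap L (pos i, False) = amap L (pos j, True)"
      if "amap L (pos i, True) = amap L (pos j, False)"
      using arc[of i] arc[of j] that by simp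
    show "amap L (pos i, True) = amap L (pos j, True)"
      if "amap L (pos i, False) = amap L (pos j, False)"
      using arc(4)[of i] arc(4)[of j] that by (simp add: G.arev_eq_iff)
    show "amap L (pos i, True) \<noteq> amap L (pos i, False)"
      using arc[of i] G.arev_neq by metis
    show "amap L (pos i, True) \<noteq> amap L (pos (i - 1), False)"
    proof
      assume eq: "amap L (pos i, True) = amap L (pos (i - 1), False)"
      have "inj_on (amap L) (out_arcs (cycle_graph n) (pos i))"
        using L pos by (simp add: immersion_def)
      moreover have "(pos i, True) \<in> out_arcs (cycle_graph n) (pos i)"
        "(pos (i - 1), False) \<in> out_arcs (cycle_graph n) (pos i)"
        using pos[of i] pos[of "i - 1"] Suc_pos[of "i - 1"] by simp_all
      ultimately show False using eq by (auto dest: inj_onD)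
    qed
  qed
  then show ?thesis by (simp only: pos_def)
qed

text \<open>
  Reduction modulo the period \<open>m\<close> is a covering of circles of degree \<open>n div m\<close>, and the loop factors
  through it.
\<close>

lemma periodic_loop_not_primitive:
  assumes L: "immersion (cycle_graph n) (cycle_rev n) G r L"
    and m: "m dvd n" "1 \<le> m" "m < n"
    and per: "\<And>x b. x < n \<Longrightarrow> amap L (x, b) = amap L (x mod m, b)"
  shows "\<not> primitive_loop n G r L"
proof -
  let ?C = "cycle_graph n" and ?D = "cycle_graph m"
  define p :: "(nat, nat \<times> bool, nat, nat \<times> bool) graph_map"
    where "p = \<lparr>vmap = \<lambda>x. x mod m, amap = \<lambda>(x, b). (x mod m, b)\<rparr>"
  have mor: "graph_morphism ?C (cycle_rev n) G r L" using L by (simp add: immersion_def)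
  note arc = loop_arcs[OF mor]
  have vper: "vmap L x = vmap L (x mod m)" if "x < n" for x
  proof -
    have "x mod m < n" using m by (meson less_trans mod_less_divisor zero_less_one less_le_trans)
    then show ?thesis using arc(2)[OF that, of True] arc(2)[of "x mod m" True] per[OF that] by simp
  qed
  have modm: "(Suc x mod n) mod m = Suc (x mod m) mod m" for x
    using m(1) by (simp add: mod_mod_cancel mod_Suc_eq)
  have pred: "(v + n - 1) mod n mod m = (v mod m + m - 1) mod m" for v
  proof -
    obtain q where q: "n = m + m * q"
      using m by (metis dvdE le_add_diff_inverse less_imp_le_nat dvd_diff_nat dvd_refl)
    have "(v + n - 1) mod n mod m = (v + n - 1) mod m" using m(1) by (rule mod_mod_cancel)
    also have "(v + n - 1) mod m = (v + (m - 1) + m * q) mod m"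
      by (rule arg_cong[where f = "\<lambda>z. z mod m"]) (use q m(2) in simp)
    also have "\<dots> mod m = (v mod m + (m - 1)) mod m" by (simp only: mod_mult_self2 mod_add_left_eq mod_mod_trivial)
    finally show ?thesis using m(2) by simp
  qed
  have cov: "covering_map ?C (cycle_rev n) ?D (cycle_rev m) p"
    unfolding covering_map_def
  proof (intro conjI ballI)
    show "graph_morphism ?C (cycle_rev n) ?D (cycle_rev m) p"
      using m by (auto simp: graph_morphism_def p_def cycle_rev_def modm)
    show "vmap p ` verts ?C = verts ?D"
    proof
      show "verts ?D \<subseteq> vmap p ` verts ?C"
      proof
        fix x assume "x \<in> verts ?D"
        then have "x = vmap p x" "x \<in> verts ?C" using m by (simp_all add: p_def)
        then show "x \<in> vmap p ` verts ?C" by (rule image_eqI)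
      qed
    qed (use m in \<open>auto simp: p_def\<close>)
    fix v assume "v \<in> verts ?C"
    then have v: "v < n" "v mod m < m" using m by simp_all
    show "bij_betw (amap p) (out_arcs ?C v) (out_arcs ?D (vmap p v))"
      using v pred[of v] by (auto simp: out_arcs_cycle_graph p_def bij_betw_def)
  qed
  have deg: "covering_degree ?C ?D p > 1"
  proof -
    define w where "w = (SOME w. w \<in> verts ?D)"
    have w: "w < m" using m someI[of "\<lambda>w. w \<in> verts ?D" 0] by (simp add: w_def)
    \<comment> \<open>Two points of one fibre are enough, and \<open>2 * m \<le> n\<close> gives \<open>w\<close> and \<open>w + m\<close>.\<close>
    have "m \<le> n - m" using m by (intro dvd_imp_le) auto
    then have "w + m < n" using w by simp
    then have "{w, w + m} \<subseteq> {v \<in> verts ?C. vmap p v = w}" using w by (simp add: p_def)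
    then have "card {w, w + m} \<le> card {v \<in> verts ?C. vmap p v = w}"
      by (intro card_mono) auto
    then show ?thesis using m by (simp add: covering_degree_def w_def)
  qed
  have K: "immersion ?D (cycle_rev m) G r L"
    unfolding immersion_def
  proof (intro conjI ballI)
    have wrap: "vmap L (Suc x mod n) = vmap L (Suc x mod m)" if "x < m" for x
      using vper[of "Suc x mod n"] modm[of x] m that by simp
    show "graph_morphism ?D (cycle_rev m) G r L"
      unfolding graph_morphism_def
    proof (intro conjI ballI)
      show "vmap L x \<in> verts G" if "x \<in> verts ?D" for x
        using mor m that by (simp add: graph_morphism_def)
      fix a assume "a \<in> arcs ?D"
      then obtain x b where a: "a = (x, b)" "x < m" "x < n" using m by auto
      show "amap L a \<in> arcs G" "tail G (amap L a) = vmap L (tail ?D a)"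
        "head G (amap L a) = vmap L (head ?D a)"
        using arc(1-3)[OF a(3), of b] wrap[OF a(2)] unfolding a(1) by simp_all
      show "amap L (cycle_rev m a) = r (amap L a)"
        using arc(4,5)[OF a(3)] a by (cases b) (simp_all only: cycle_rev_def, simp_all)
    qed
    fix v assume "v \<in> verts ?D"
    then have v: "v < m" "v < n" using m by simp_all
    have "inj_on (amap L) (out_arcs ?C v)" using L v by (simp add: immersion_def)
    then have "amap L (v, True) \<noteq> amap L ((v + n - 1) mod n, False)"
      unfolding out_arcs_cycle_graph[OF v(2)] by (auto dest: inj_onD)
    moreover have "amap L ((v + n - 1) mod n, False) = amap L ((v + m - 1) mod m, False)"
      using per[of "(v + n - 1) mod n" False] pred[of v] v by simp
    ultimately show "inj_on (amap L) (out_arcs ?D v)"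
      unfolding out_arcs_cycle_graph[OF v(1)] by simp
  qed
  have "(\<forall>v\<in>verts ?C. vmap L v = vmap L (vmap p v)) \<and> (\<forall>a\<in>arcs ?C. amap L a = amap L (amap p a))"
  proof (intro conjI ballI)
    show "vmap L v = vmap L (vmap p v)" if "v \<in> verts ?C" for v using that vper by (simp add: p_def)
    show "amap L a = amap L (amap p a)" if "a \<in> arcs ?C" for a
      using that per[of "fst a" "snd a"] by (auto simp: p_def)
  qed
  then show ?thesis unfolding primitive_loop_def using cov deg K m(2) by blast
qed

text \<open>
  With \<open>d\<close> also \<open>gcd d n\<close> is a period, so primitivity forces this divisor of \<open>n\<close> to be \<open>n\<close> itself.
\<close>

lemma primitive_loop_period:
  assumes prim: "primitive_loop n G r L" and n: "n \<ge> 1"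
    and per: "\<And>i. amap L (nat ((i + d) mod int n), True) = amap L (nat (i mod int n), True)"
  shows "int n dvd d"
proof (rule ccontr)
  assume nd: "\<not> int n dvd d"
  have L: "immersion (cycle_graph n) (cycle_rev n) G r L" using prim by (simp add: primitive_loop_def)
  define F where "F i = amap L (nat (i mod int n), True)" for i
  have Fd: "F (i + d) = F i" for i using per by (simp add: F_def)
  have up: "F (i + int k * d) = F i" for i k
  proof (induction k)
    case (Suc k)
    then show ?case using Fd[of "i + int k * d"] by (simp add: algebra_simps)
  qed simp
  have Fk: "F (i + k * d) = F i" for i k
    using up[of i "nat k"] up[of "i + k * d" "nat (- k)"] by (cases "k \<ge> 0") auto
  define m where "m = nat (gcd d (int n))"
  have im: "int m = gcd d (int n)" by (simp add: m_def)
  obtain u v where uv: "u * d + v * int n = int m" using bezout_int[of d "int n"] im by metis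
  have Fm: "F (i + k * int m) = F i" for i k
  proof -
    have "F (i + k * int m) = F (i + k * u * d + k * v * int n)"
      using uv by (metis distrib_left mult.assoc add.assoc)
    also have "\<dots> = F (i + (k * u) * d)" by (simp add: F_def)
    finally show ?thesis using Fk by simp
  qed
  have "int m dvd int n" unfolding im by simp
  then have mn: "m dvd n" by simp
  have "gcd d (int n) > 0" using n by (simp add: gcd_pos_int)
  then have m1: "m \<ge> 1" unfolding m_def by linarith
  have "m \<noteq> n" using im nd by (metis gcd_dvd1)
  then have m: "m dvd n" "1 \<le> m" "m < n" using mn m1 n dvd_imp_le[of m n] by auto
  have T: "amap L (x, True) = amap L (x mod m, True)" if "x < n" for x
  proof -
    have "x mod m < n" using m that by (meson le_less_trans mod_less_eq_dividend)
    moreover have "int x = int (x mod m) + int (x div m) * int m"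
      by (metis mod_div_mult_eq of_nat_add of_nat_mult)
    then have "F (int x) = F (int (x mod m))" using Fm[of "int (x mod m)" "int (x div m)"] by metis
    ultimately show ?thesis using that by (simp add: F_def)
  qed
  have "amap L (x, b) = amap L (x mod m, b)" if "x < n" for x b
  proof (cases b)
    case False
    have "amap L (y, False) = r (amap L (y, True))" if "y < n" for y
      using L that loop_arcs(4) by (auto simp: immersion_def)
    then show ?thesis using T[OF that] that False le_less_trans[OF mod_less_eq_dividend that] by simp
  qed (use T that in simp)
  then show False using periodic_loop_not_primitive[OF L m] prim by blast
qed

text \<open>
  The positions that the height function of \<open>stacking_exists\<close> does not separate differ by a period
  of the loop; by primitivity they are equal.
\<close>

theorem primitive_loop_has_stacking:
  assumes G: "bidirected_digraph G r" and n: "n \<ge> 1" and prim: "primitive_loop n G r L"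
  shows "\<exists>h. stacking (cycle_graph n) L h"
proof -
  have L: "immersion (cycle_graph n) (cycle_rev n) G r L" using prim by (simp add: primitive_loop_def)
  define pos where "pos i = nat (i mod int n)" for i
  interpret I: immersed_circle "int n" "\<lambda>i. vmap L (pos i)" "\<lambda>i. amap L (pos i, True)" "\<lambda>i. amap L (pos i, False)"
    unfolding pos_def by (rule loop_immersed_circle[OF G n L])
  obtain h where h: "I.pre_stacking h"
      "\<And>i j. vmap L (pos i) = vmap L (pos j) \<Longrightarrow> h i = h j \<Longrightarrow> int n dvd i - j"
    using I.stacking_exists primitive_loop_period[OF prim n] unfolding pos_def by blast
  define k where "k x = h (int x)" for x
  have k_Suc: "k (Suc x mod n) = h (int x + 1)" for x
    using I.pre_stackingD(1)[OF h(1), of "int x + 1"] by (simp add: k_def zmod_int add.commute)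
  have pos_int: "pos (int x) = x" if "x < n" for x using that by (simp add: pos_def)
  have inj: "inj_on (\<lambda>v. (vmap L v, k v)) (verts (cycle_graph n))"
  proof (rule inj_onI)
    fix x y assume xy: "x \<in> verts (cycle_graph n)" "y \<in> verts (cycle_graph n)" "(vmap L x, k x) = (vmap L y, k y)"
    then have "int n dvd int x - int y" using h(2)[of "int x" "int y"] by (simp add: pos_int k_def)
    then have "int x mod int n = int y mod int n" by (simp add: mod_eq_dvd_iff)
    then show "x = y" using xy by simp
  qed
  have sgn_less: "(a < b \<longleftrightarrow> c < d) \<and> (b < a \<longleftrightarrow> d < c)" if "sgn (a - b) = sgn (c - d)" for a b c d :: int
    using that by (auto simp: sgn_if split: if_splits)
  have TT: "k x < k y \<longleftrightarrow> k (Suc x mod n) < k (Suc y mod n)"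
    if "x < n" "y < n" "amap L (x, True) = amap L (y, True)" for x y
  proof -
    have "sgn (k x - k y) = sgn (k (Suc x mod n) - k (Suc y mod n))"
      using I.pre_stackingD(2)[OF h(1), of "int x" "int y"] that
      unfolding k_Suc unfolding k_def by (simp add: pos_int)
    then show ?thesis by (rule sgn_less[THEN conjunct1])
  qed
  have TF: "(k x < k (Suc y mod n) \<longleftrightarrow> k (Suc x mod n) < k y) \<and> (k (Suc y mod n) < k x \<longleftrightarrow> k y < k (Suc x mod n))"
    if "x < n" "y < n" "amap L (x, True) = amap L (y, False)" for x y
  proof -
    have "sgn (k x - k (Suc y mod n)) = sgn (k (Suc x mod n) - k y)"
      using I.pre_stackingD(3)[OF h(1), of "int x" "int y"] that
      unfolding k_Suc unfolding k_def by (simp add: pos_int)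
    then show ?thesis by (rule sgn_less)
  qed
  have "stacking (cycle_graph n) L k"
    unfolding stacking_def
  proof (intro conjI ballI impI inj)
    fix a b assume ab: "a \<in> arcs (cycle_graph n)" "b \<in> arcs (cycle_graph n)" "amap L a = amap L b"
    obtain x c y d where a: "a = (x, c)" and b: "b = (y, d)" by (cases a, cases b)
    have xy: "x < n" "y < n" using ab a b by simp_all
    have FF: "amap L (x, False) = amap L (y, False) \<Longrightarrow> amap L (x, True) = amap L (y, True)"
      using I.BB[of "int x" "int y"] xy by (simp add: pos_int)
    show "k (tail (cycle_graph n) a) < k (tail (cycle_graph n) b) \<longleftrightarrow>
        k (head (cycle_graph n) a) < k (head (cycle_graph n) b)"
    proof (cases c; cases d)
      assume "c" "d" then show ?thesis using TT[OF xy] ab a b by simp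
    next
      assume "c" "\<not> d" then show ?thesis using TF[OF xy] ab a b by simp
    next
      assume "\<not> c" "d" then show ?thesis using TF[OF xy(2,1)] ab a b by simp
    next
      assume "\<not> c" "\<not> d" then show ?thesis using TT[OF xy] FF ab a b by simp
    qed
  qed
  then show ?thesis by blast
qed

section \<open>Counting visible edges\<close>

lemma mod_add_left_cancel:
  fixes a b t n :: nat
  assumes "(t + a) mod n = (t + b) mod n" "a < n" "b < n"
  shows "a = b"
  using assms
proof (induction a b rule: linorder_wlog)
  case (le a b)
  then have "n dvd b - a" using mod_eq_dvd_iff_nat[of "t + a" "t + b" n] by simp
  then show ?case using le nat_dvd_not_less[of "b - a" n] by force
qed simp

text \<open>
  A graph \<open>S\<close> that covers a circle by \<open>\<sigma>\<close> and is immersed in \<open>G\<close> by \<open>f\<close>, with a stacking whose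
  heights are pulled back from the circle. Because of the last property, every component of \<open>S\<close>
  contains points that are highest, and points that are lowest, among all points with the same image
  in \<open>G\<close>. The reversal \<open>s\<close> may be defined on a larger graph.
\<close>

locale stacked_cover =
  fixes G :: "('v,'e) pre_digraph" and r :: "'e \<Rightarrow> 'e"
    and S :: "('w,'d) pre_digraph" and s :: "'d \<Rightarrow> 'd"
    and f :: "('w,'d,'v,'e) graph_map" and n :: nat
    and \<sigma> :: "('w,'d,nat,nat \<times> bool) graph_map" and h :: "nat \<Rightarrow> int"
  assumes G: "bidirected_digraph G r" and fin_G: "fin_digraph G"
    and no_isolated: "\<And>v. v \<in> verts G \<Longrightarrow> \<exists>a\<in>arcs G. tail G a = v"
    and S: "wf_digraph S" and fin_S: "finite (verts S)"
    and s_arcs: "\<And>a. a \<in> arcs S \<Longrightarrow> s a \<in> arcs S"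
    and s_s: "\<And>a. a \<in> arcs S \<Longrightarrow> s (s a) = a"
    and tail_s: "\<And>a. a \<in> arcs S \<Longrightarrow> tail S (s a) = head S a"
    and f: "immersion S s G r f"
    and \<sigma>: "graph_morphism S s (cycle_graph n) (cycle_rev n) \<sigma>"
    and \<sigma>_bij: "\<And>v. v \<in> verts S \<Longrightarrow>
      bij_betw (amap \<sigma>) (out_arcs S v) (out_arcs (cycle_graph n) (vmap \<sigma> v))"
    and n: "n \<ge> 1"
    and stack: "stacking S f (h \<circ> vmap \<sigma>)"
begin

interpretation G: bidirected_digraph G r by (rule G)
interpretation G: fin_digraph G by (rule fin_G)
interpretation S: wf_digraph S by (rule S)

abbreviation height :: "'w \<Rightarrow> int" where
  "height u \<equiv> h (vmap \<sigma> u)"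

lemma head_s: "a \<in> arcs S \<Longrightarrow> head S (s a) = tail S a"
  using tail_s[of "s a"] s_arcs[of a] s_s[of a] by simp

lemma \<sigma>_lt: "u \<in> verts S \<Longrightarrow> vmap \<sigma> u < n"
  using \<sigma> by (auto simp: graph_morphism_def)

lemma f_arc:
  assumes "a \<in> arcs S"
  shows "amap f a \<in> arcs G" "tail G (amap f a) = vmap f (tail S a)"
    "head G (amap f a) = vmap f (head S a)" "amap f (s a) = r (amap f a)"
  using f assms by (auto simp: immersion_def graph_morphism_def)

lemma height_inj:
  "u \<in> verts S \<Longrightarrow> v \<in> verts S \<Longrightarrow> vmap f u = vmap f v \<Longrightarrow> height u = height v \<Longrightarrow> u = v"
  using stack unfolding stacking_def inj_on_def by simp

lemma height_mono:
  "a \<in> arcs S \<Longrightarrow> b \<in> arcs S \<Longrightarrow> amap f a = amap f b \<Longrightarrow>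
     height (tail S a) < height (tail S b) \<longleftrightarrow> height (head S a) < height (head S b)"
  using stack unfolding stacking_def by simp

lemma f_arc_inj:
  assumes "a \<in> arcs S" "b \<in> arcs S" "amap f a = amap f b" "tail S a = tail S b"
  shows "a = b"
proof -
  have "inj_on (amap f) (out_arcs S (tail S a))"
    using f assms(1) by (simp add: immersion_def)
  then show ?thesis by (rule inj_onD) (use assms in auto)
qed

lemma same_lift:
  assumes "a \<in> arcs S" "b \<in> arcs S" "amap f a = amap f b" "height (tail S a) = height (tail S b)"
  shows "a = b"
  using assms f_arc(2)[of a] f_arc(2)[of b]
  by (intro f_arc_inj height_inj) auto

text \<open>
  The arc that leaves \<open>u\<close> in the positive direction of the circle. Every edge of \<open>S\<close> is named by the
  vertex at which it starts in this sense.
\<close>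

definition fwd :: "'w \<Rightarrow> 'd" where
  "fwd u = (THE a. a \<in> arcs S \<and> tail S a = u \<and> amap \<sigma> a = (vmap \<sigma> u, True))"

lemma fwd:
  assumes "u \<in> verts S"
  shows "fwd u \<in> arcs S" "tail S (fwd u) = u" "amap \<sigma> (fwd u) = (vmap \<sigma> u, True)"
proof -
  have "\<exists>!a. a \<in> arcs S \<and> tail S a = u \<and> amap \<sigma> a = (vmap \<sigma> u, True)"
  proof -
    have "(vmap \<sigma> u, True) \<in> out_arcs (cycle_graph n) (vmap \<sigma> u)" using \<sigma>_lt[OF assms] by simp
    then obtain a where "a \<in> out_arcs S u" "amap \<sigma> a = (vmap \<sigma> u, True)"
      using \<sigma>_bij[OF assms] unfolding bij_betw_def by (metis imageE)
    moreover have "inj_on (amap \<sigma>) (out_arcs S u)" using \<sigma>_bij[OF assms] by (simp add: bij_betw_def)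
    ultimately show ?thesis unfolding inj_on_def by (metis in_out_arcs_conv)
  qed
  from theI'[OF this] show "fwd u \<in> arcs S" "tail S (fwd u) = u" "amap \<sigma> (fwd u) = (vmap \<sigma> u, True)"
    unfolding fwd_def by simp_all
qed

definition nxt :: "'w \<Rightarrow> 'w" where
  "nxt u = head S (fwd u)"

lemma nxt_in: "u \<in> verts S \<Longrightarrow> nxt u \<in> verts S"
  unfolding nxt_def using fwd(1) by simp

lemma \<sigma>_nxt: "u \<in> verts S \<Longrightarrow> vmap \<sigma> (nxt u) = Suc (vmap \<sigma> u) mod n"
proof -
  assume u: "u \<in> verts S"
  have "vmap \<sigma> (head S (fwd u)) = head (cycle_graph n) (amap \<sigma> (fwd u))"
    using \<sigma> fwd(1)[OF u] by (simp add: graph_morphism_def)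
  then show ?thesis using fwd(3)[OF u] by (simp add: nxt_def)
qed

lemma \<sigma>_rev_fwd: "u \<in> verts S \<Longrightarrow> amap \<sigma> (s (fwd u)) = (vmap \<sigma> u, False)"
  using \<sigma> fwd[of u] \<sigma>_lt[of u] by (simp add: graph_morphism_def cycle_rev_def)

lemma inj_nxt: "inj_on nxt (verts S)"
proof (rule inj_onI)
  fix u v assume uv: "u \<in> verts S" "v \<in> verts S" "nxt u = nxt v"
  have "Suc (vmap \<sigma> u) mod n = Suc (vmap \<sigma> v) mod n" using \<sigma>_nxt uv by metis
  then have "vmap \<sigma> u = vmap \<sigma> v"
    using \<sigma>_lt[OF uv(1)] \<sigma>_lt[OF uv(2)] by (auto simp: mod_Suc split: if_splits)
  then have "amap \<sigma> (s (fwd u)) = amap \<sigma> (s (fwd v))" using \<sigma>_rev_fwd uv by simp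
  moreover have "s (fwd u) \<in> out_arcs S (nxt u)" "s (fwd v) \<in> out_arcs S (nxt u)"
    using s_arcs tail_s fwd(1) uv by (simp_all add: nxt_def)
  moreover have "inj_on (amap \<sigma>) (out_arcs S (nxt u))"
    using \<sigma>_bij[OF nxt_in[OF uv(1)]] by (simp add: bij_betw_def)
  ultimately have "s (fwd u) = s (fwd v)" by (metis inj_onD)
  then show "u = v" using head_s fwd uv by metis
qed

text \<open>
  Walking along \<open>S\<close> is a permutation of its vertices that covers the rotation of the circle.
\<close>

lemma iterate_nxt:
  shows "bij_betw (nxt ^^ t) (verts S) (verts S)"
    and "u \<in> verts S \<Longrightarrow> vmap \<sigma> ((nxt ^^ t) u) = (vmap \<sigma> u + t) mod n"
proof -
  have "nxt ` verts S = verts S"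
    using inj_nxt nxt_in fin_S by (intro endo_inj_surj) auto
  then have bij: "bij_betw nxt (verts S) (verts S)" using inj_nxt by (simp add: bij_betw_def)
  show b: "bij_betw (nxt ^^ t) (verts S) (verts S)" for t
  proof (induction t)
    case (Suc t)
    show ?case using bij_betw_trans[OF Suc bij] by (simp add: comp_def)
  qed (simp add: bij_betw_def)
  show "u \<in> verts S \<Longrightarrow> vmap \<sigma> ((nxt ^^ t) u) = (vmap \<sigma> u + t) mod n"
  proof (induction t)
    case (Suc t)
    then have "(nxt ^^ t) u \<in> verts S" using b bij_betwE by blast
    then show ?case using Suc \<sigma>_nxt by (simp add: mod_Suc_eq)
  qed (use \<sigma>_lt in simp)
qed

text \<open>
  The vertices and edges of \<open>S\<close> that are visible from above, that is, highest among those with the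
  same image in \<open>G\<close>. An edge is compared at its starting vertex; in a stacking its other end would give
  the same result.
\<close>

definition top_verts :: "'w set" where
  "top_verts = {u \<in> verts S. \<forall>v\<in>verts S. vmap f v = vmap f u \<longrightarrow> height v \<le> height u}"

definition top_edges :: "'w set" where
  "top_edges = {u \<in> verts S. \<forall>a\<in>arcs S. amap f a = amap f (fwd u) \<longrightarrow> height (tail S a) \<le> height u}"

lemma top_edgesD: "u \<in> top_edges \<Longrightarrow> a \<in> arcs S \<Longrightarrow> amap f a = amap f (fwd u) \<Longrightarrow> height (tail S a) \<le> height u"
  by (simp add: top_edges_def)

text \<open>
  Both edges at a visible vertex are visible: an edge above one of them would end above the vertex.
\<close>

lemma top_edge_after: "top_verts \<subseteq> top_edges"
proof
  fix u assume u: "u \<in> top_verts"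
  then have uS: "u \<in> verts S" by (simp add: top_verts_def)
  have "height (tail S a) \<le> height u" if "a \<in> arcs S" "amap f a = amap f (fwd u)" for a
  proof -
    have "vmap f (tail S a) = vmap f u"
      using that f_arc(2)[of a] f_arc(2)[of "fwd u"] fwd[OF uS] by simp
    then show ?thesis using u that(1) by (simp add: top_verts_def)
  qed
  then show "u \<in> top_edges" using uS by (simp add: top_edges_def)
qed

lemma top_edge_before:
  assumes u: "u \<in> verts S" and top: "nxt u \<in> top_verts"
  shows "u \<in> top_edges"
proof -
  have "height (tail S a) \<le> height u" if a: "a \<in> arcs S" "amap f a = amap f (fwd u)" for a
  proof -
    have "vmap f (head S a) = vmap f (nxt u)"
      using a f_arc(3)[of a] f_arc(3)[of "fwd u"] fwd[OF u] by (simp add: nxt_def)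
    then have "height (head S a) \<le> height (nxt u)" using top a(1) by (simp add: top_verts_def)
    then show ?thesis
      using height_mono[of "fwd u" a] a fwd[OF u] by (simp add: nxt_def)
  qed
  then show ?thesis using u by (simp add: top_edges_def)
qed

text \<open>
  Each edge of \<open>G\<close> has at most one visible lift. This is clear for two lifts that run in the same
  direction. Of two lifts in opposite directions, each would start no lower than the other one ends;
  since the order at both ends is the same, the heights agree and the lifts coincide, although an
  edge of the circle is never its own reverse.
\<close>

lemma card_top_edges: "card top_edges \<le> card (edges G r)"
proof (rule card_inj_on_le)
  let ?e = "\<lambda>u. {amap f (fwd u), r (amap f (fwd u))}"
  show "finite (edges G r)" unfolding edges_def by simp
  show "?e ` top_edges \<subseteq> edges G r" using f_arc(1) fwd(1) by (auto simp: edges_def top_edges_def)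
  show "inj_on ?e top_edges"
  proof (rule inj_onI)
    fix u v assume t: "u \<in> top_edges" "v \<in> top_edges" and e: "?e u = ?e v"
    then have uv: "u \<in> verts S" "v \<in> verts S" by (simp_all add: top_edges_def)
    note fu = fwd[OF uv(1)] and fv = fwd[OF uv(2)]
    from e consider "amap f (fwd u) = amap f (fwd v)"
      | "amap f (fwd u) = r (amap f (fwd v))" "amap f (fwd v) = r (amap f (fwd u))"
      unfolding doubleton_eq_iff by metis
    then show "u = v"
    proof cases
      case 1
      then have "height u = height v"
        using top_edgesD[OF t(1) fv(1)] top_edgesD[OF t(2) fu(1)] fu fv by simp
      then show ?thesis using same_lift[OF fu(1) fv(1) 1] fu fv by metis
    next
      case 2
      have c: "s (fwd v) \<in> arcs S" "amap f (s (fwd v)) = amap f (fwd u)"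
          "tail S (s (fwd v)) = nxt v" "head S (s (fwd v)) = v"
        and c': "s (fwd u) \<in> arcs S" "amap f (s (fwd u)) = amap f (fwd v)" "tail S (s (fwd u)) = nxt u"
        using fu fv f_arc(4) 2 s_arcs tail_s head_s by (simp_all add: nxt_def)
      have "height (nxt v) \<le> height u" "height (nxt u) \<le> height v"
        using top_edgesD[OF t(1) c(1,2)] top_edgesD[OF t(2) c'(1,2)] c(3) c'(3) by simp_all
      moreover have "height (nxt v) < height u \<longleftrightarrow> height v < height (nxt u)"
        using height_mono[OF c(1) fu(1) c(2)] c fu by (simp add: nxt_def)
      ultimately have "s (fwd v) = fwd u"
        by (intro same_lift[OF c(1) fu(1) c(2)]) (simp add: c fu)
      then have False using \<sigma>_rev_fwd[OF uv(2)] fu(3) by simp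
      then show ?thesis ..
    qed
  qed
qed

lemma edge_has_lift:
  assumes irr: "\<not> reducible S s G r f" and a: "a \<in> arcs G"
  shows "\<exists>b\<in>arcs S. amap f b = a"
proof -
  have "{a, r a} \<in> edges G r" using a by (simp add: edges_def)
  moreover have "reducible S s G r f"
    if "{d \<in> edges S s. amap f ` d = {a, r a}} = {}" "{a, r a} \<in> edges G r"
    unfolding reducible_def by (rule bexI[OF _ that(2)], unfold that(1)) simp
  ultimately obtain b where b: "b \<in> arcs S" "amap f ` {b, s b} = {a, r a}"
    using irr unfolding edges_def by blast
  then have "a = amap f b \<or> a = amap f (s b)" by auto
  then show ?thesis using b(1) s_arcs by auto
qed

lemma card_top_verts:
  assumes irr: "\<not> reducible S s G r f"
  shows "card (verts G) \<le> card top_verts"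
proof (rule surj_card_le)
  show "finite top_verts" using fin_S by (simp add: top_verts_def)
  show "verts G \<subseteq> vmap f ` top_verts"
  proof
    fix x assume "x \<in> verts G"
    then obtain a where "a \<in> arcs G" "tail G a = x" using no_isolated by blast
    then obtain b where b: "b \<in> arcs S" "vmap f (tail S b) = x"
      using edge_has_lift[OF irr] f_arc(2) by metis
    define F where "F = {u \<in> verts S. vmap f u = x}"
    have "tail S b \<in> F" "finite F" using fin_S b by (simp_all add: F_def)
    then have "Max (height ` F) \<in> height ` F" by (intro Max_in) auto
    then obtain u where u: "u \<in> F" "height u = Max (height ` F)" by auto
    have "height v \<le> height u" if "v \<in> F" for v
      unfolding u(2) using that \<open>finite F\<close> by (intro Max_ge) auto
    then have "u \<in> top_verts" using u(1) by (auto simp: top_verts_def F_def)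
    then show "x \<in> vmap f ` top_verts" using u(1) by (auto simp: F_def)
  qed
qed

text \<open>
  An edge that is both highest and lowest among the lifts of its image is the only lift.
\<close>

lemma top_and_bottom_imp_reducible:
  assumes u: "u \<in> top_edges" and bot: "\<And>i. i < n \<Longrightarrow> height u \<le> h i"
  shows "reducible S s G r f"
proof -
  have uS: "u \<in> verts S" using u by (simp add: top_edges_def)
  note fu = fwd[OF uS]
  have lift: "c = fwd u" if c: "c \<in> arcs S" "amap f c = amap f (fwd u)" for c
  proof (rule same_lift[OF c(1) fu(1) c(2)])
    show "height (tail S c) = height (tail S (fwd u))"
      using top_edgesD[OF u c] bot[OF \<sigma>_lt[of "tail S c"]] c(1) fu by force
  qed
  let ?e = "{amap f (fwd u), r (amap f (fwd u))}"
  have sub: "{d \<in> edges S s. amap f ` d = ?e} \<subseteq> {{fwd u, s (fwd u)}}"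
  proof clarify
    fix d assume d: "d \<in> edges S s" "amap f ` d = ?e"
    then obtain b where b: "b \<in> arcs S" "d = {b, s b}" by (auto simp: edges_def)
    have "amap f (fwd u) \<in> amap f ` d" using d(2) by simp
    then have "b = fwd u \<or> s b = fwd u" using lift b s_arcs by auto
    then show "d = {fwd u, s (fwd u)}" using b s_s[OF b(1)] by auto
  qed
  have "?e \<in> edges G r" using f_arc(1)[OF fu(1)] by (simp add: edges_def)
  moreover have "finite {d \<in> edges S s. amap f ` d = ?e}" using sub finite_subset by blast
  moreover have "card {d \<in> edges S s. amap f ` d = ?e} \<le> 1" using card_mono[OF _ sub] by simp
  ultimately show ?thesis unfolding reducible_def by blast
qed

text \<open>
  The visible part of \<open>S\<close> consists of arcs, and an arc begins with a visible edge whose initial vertex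
  is not visible. Going back from a visible vertex one stays in the visible part until such an edge is
  met. This happens within one turn around the circle, since a full turn passes over the lowest point
  of the circle, and an edge that starts there is not visible unless \<open>f\<close> is reducible.
\<close>

lemma initial_edge_exists:
  assumes irr: "\<not> reducible S s G r f" and u: "u \<in> top_verts"
  shows "\<exists>t<n. \<exists>w\<in>top_edges - top_verts. (nxt ^^ t) w = u"
proof (rule ccontr)
  assume none: "\<not> ?thesis"
  have pred_top: "w \<in> top_verts" if "t < n" "w \<in> verts S" "(nxt ^^ t) w = u" for t w
    using that
  proof (induction t arbitrary: w)
    case 0
    then show ?case using u by simp
  next
    case (Suc t)
    then have "nxt w \<in> top_verts" using nxt_in by (simp add: funpow_swap1)
    then have "w \<in> top_edges" using top_edge_before Suc.prems by blast
    then show ?case using none Suc.prems by blast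
  qed
  have uS: "u \<in> verts S" using u by (simp add: top_verts_def)
  have "Min (h ` {..<n}) \<in> h ` {..<n}" using n by (intro Min_in) (auto simp: lessThan_empty_iff)
  then obtain y where y: "y < n" "h y = Min (h ` {..<n})" by auto
  \<comment> \<open>The number of steps from the lowest point to the image of \<open>u\<close>; adding \<open>n\<close> keeps the subtraction
    from truncating.\<close>
  define t where "t = (vmap \<sigma> u + n - y) mod n"
  have t: "t < n" using n by (simp add: t_def)
  obtain w where w: "w \<in> verts S" "(nxt ^^ t) w = u"
    using iterate_nxt(1)[of t] uS unfolding bij_betw_def by (metis imageE)
  have "(vmap \<sigma> w + t) mod n = vmap \<sigma> u" using iterate_nxt(2)[OF w(1), of t] w(2) by simp
  moreover have "(y + t) mod n = vmap \<sigma> u"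
    using y(1) \<sigma>_lt[OF uS] by (simp add: t_def mod_add_right_eq)
  ultimately have "vmap \<sigma> w = y"
    using mod_add_left_cancel[of t "vmap \<sigma> w" n y] y(1) \<sigma>_lt[OF w(1)] by (simp add: add.commute)
  then have "height w \<le> h i" if "i < n" for i using that y(2) by simp
  then show False using top_and_bottom_imp_reducible irr pred_top[OF t w] top_edge_after by blast
qed

text \<open>
  Visible edges and vertices correspond to edges and vertices of \<open>G\<close>, so there are at most
  \<open>- \<chi>(G)\<close> visible edges with an invisible initial vertex. Over the highest point of the circle all
  points of \<open>S\<close> are visible, and going back from them leads to different initial edges: less than a
  full turn is made, so the number of steps can be read off from the image in the circle.
\<close>

theorem degree_le:
  assumes irr: "\<not> reducible S s G r f"
  shows "int (covering_degree S (cycle_graph n) \<sigma>) \<le> - euler_char G r"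
proof -
  have "Max (h ` {..<n}) \<in> h ` {..<n}" using n by (intro Max_in) (auto simp: lessThan_empty_iff)
  then obtain y where y: "y < n" "h y = Max (h ` {..<n})" by auto
  define fib where "fib y = {u \<in> verts S. vmap \<sigma> u = y}" for y
  have fin_fib: "finite (fib z)" for z using fin_S by (simp add: fib_def)
  have top: "u \<in> top_verts" if "u \<in> fib y" for u
    using that y \<sigma>_lt by (auto simp: top_verts_def fib_def intro!: Max_ge)
  have "\<forall>u\<in>fib y. \<exists>w. w \<in> top_edges - top_verts \<and> (\<exists>t<n. (nxt ^^ t) w = u)"
    using initial_edge_exists[OF irr top] by blast
  then obtain w where w: "\<And>u. u \<in> fib y \<Longrightarrow> w u \<in> top_edges - top_verts"
      "\<And>u. u \<in> fib y \<Longrightarrow> \<exists>t<n. (nxt ^^ t) (w u) = u"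
    by (metis (no_types, lifting))
  have inj: "inj_on w (fib y)"
  proof (rule inj_onI)
    fix u v assume uv: "u \<in> fib y" "v \<in> fib y" "w u = w v"
    obtain t t' where t: "t < n" "(nxt ^^ t) (w u) = u" "t' < n" "(nxt ^^ t') (w u) = v"
      using w(2)[OF uv(1)] w(2)[OF uv(2)] uv(3) by auto
    have wS: "w u \<in> verts S" using w(1)[OF uv(1)] by (simp add: top_edges_def)
    have "(vmap \<sigma> (w u) + t) mod n = (vmap \<sigma> (w u) + t') mod n"
      using iterate_nxt(2)[OF wS, of t] iterate_nxt(2)[OF wS, of t'] t uv(1,2) by (simp add: fib_def)
    then have "t = t'" using mod_add_left_cancel t by blast
    then show "u = v" using t by simp
  qed
  have fin_T: "finite top_edges" using fin_S by (simp add: top_edges_def)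
  have "covering_degree S (cycle_graph n) \<sigma> \<le> card (fib y)"
  proof -
    \<comment> \<open>The degree is counted over an unspecified vertex \<open>z\<close>; walking from \<open>z\<close> to \<open>y\<close> identifies the
      fibres. Both are below \<open>n\<close>, so the subtraction does not truncate.\<close>
    define z where "z = (SOME z. z \<in> verts (cycle_graph n))"
    have z: "z < n" using n someI[of "\<lambda>z. z \<in> verts (cycle_graph n)" 0] by (simp add: z_def)
    define t where "t = y + n - z"
    have "(nxt ^^ t) ` fib z \<subseteq> fib y"
    proof clarify
      fix u assume "u \<in> fib z"
      then have u: "u \<in> verts S" "vmap \<sigma> u = z" by (simp_all add: fib_def)
      then have "(nxt ^^ t) u \<in> verts S" using iterate_nxt(1) bij_betwE by blast
      then show "(nxt ^^ t) u \<in> fib y"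
        using iterate_nxt(2)[OF u(1), of t] u(2) z y(1) by (simp add: fib_def t_def)
    qed
    moreover have "inj_on (nxt ^^ t) (fib z)"
      using iterate_nxt(1)[of t] by (auto simp: bij_betw_def fib_def intro: inj_on_subset)
    ultimately have "card (fib z) \<le> card (fib y)" using card_inj_on_le fin_fib by blast
    then show ?thesis by (simp add: covering_degree_def fib_def z_def)
  qed
  also have "card (fib y) \<le> card (top_edges - top_verts)"
    using card_inj_on_le[OF inj] w(1) fin_T by blast
  also have "\<dots> = card top_edges - card top_verts"
    by (rule card_Diff_subset[OF finite_subset[OF top_edge_after fin_T] top_edge_after])
  finally show ?thesis
    using card_top_edges card_top_verts[OF irr] card_mono[OF fin_T top_edge_after]
    unfolding euler_char_def by linarith
qed

end

section \<open>Circular components of fibre products\<close>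

lemma circular_out_degree:
  assumes C: "wf_digraph C" and circ: "circular C s" and v: "v \<in> verts C"
  shows "card (out_arcs C v) = 2"
proof -
  interpret C: wf_digraph C by (rule C)
  obtain m g where m: "m \<ge> 1" and g: "graph_isomorphism C s (cycle_graph m) (cycle_rev m) g"
    using circ by (auto simp: circular_def)
  let ?D = "cycle_graph m"
  have mor: "graph_morphism C s ?D (cycle_rev m) g"
    and vb: "bij_betw (vmap g) (verts C) (verts ?D)" and ab: "bij_betw (amap g) (arcs C) (arcs ?D)"
    using g by (simp_all add: graph_isomorphism_def)
  have gv: "vmap g v < m" using mor v by (simp add: graph_morphism_def)
  have "amap g ` out_arcs C v = out_arcs ?D (vmap g v)"
  proof (intro equalityI subsetI)
    fix b assume "b \<in> amap g ` out_arcs C v"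
    then show "b \<in> out_arcs ?D (vmap g v)" using mor by (force simp: graph_morphism_def)
  next
    fix b assume b: "b \<in> out_arcs ?D (vmap g v)"
    then have "b \<in> amap g ` arcs C" using ab by (simp add: bij_betw_def)
    then obtain a where a: "a \<in> arcs C" "b = amap g a" by blast
    then have "vmap g (tail C a) = vmap g v" using mor b by (simp add: graph_morphism_def)
    then have "tail C a = v" using vb v a(1) C.tail_in_verts by (auto simp: bij_betw_def dest: inj_onD)
    then show "b \<in> amap g ` out_arcs C v" using a by simp
  qed
  moreover have "inj_on (amap g) (out_arcs C v)"
    using ab unfolding bij_betw_def by (auto intro: inj_on_subset)
  ultimately have "card (out_arcs C v) = card (out_arcs ?D (vmap g v))" by (metis card_image)
  then show ?thesis by (simp add: out_arcs_cycle_graph[OF gv])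
qed

text \<open>
  Otherwise the component together with this arc and its end would be a larger connected subgraph.
\<close>

lemma component_closed:
  assumes G: "wf_digraph G" and C: "C \<in> components G"
    and a: "a \<in> arcs G" "tail G a \<in> verts C"
  shows "a \<in> arcs C"
proof -
  interpret G: wf_digraph G by (rule G)
  have sub: "subgraph C G" and con: "connected C"
    and max: "\<And>H. subgraph C H \<Longrightarrow> subgraph H G \<Longrightarrow> connected H \<Longrightarrow> H = C"
    using C by (auto simp: components_def G.max_subgraph_def)
  interpret C: wf_digraph C using sub by auto
  have ends: "tail C = tail G" "head C = head G" using sub by (auto simp: subgraph_def compatible_def)
  define H where "H = \<lparr>verts = insert (head G a) (verts C), arcs = insert a (arcs C), tail = tail G, head = head G\<rparr>"
  have H: "verts H = insert (head G a) (verts C)" "arcs H = insert a (arcs C)" "tail H = tail G" "head H = head G"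
    by (simp_all add: H_def)
  have wfH: "wf_digraph H"
    by unfold_locales (use a(2) C.tail_in_verts C.head_in_verts in \<open>auto simp: H ends\<close>)
  have "subgraph C H"
    using wfH C.wf_digraph_axioms by (auto simp: subgraph_def compatible_def H ends)
  moreover have "subgraph H G"
  proof -
    have "verts H \<subseteq> verts G" "arcs H \<subseteq> arcs G"
      using a(1) sub unfolding subgraph_def H by auto
    then show ?thesis using wfH G unfolding subgraph_def compatible_def H(3,4) by blast
  qed
  moreover have "connected H"
  proof -
    let ?E = "(arcs_ends H)\<^sup>s"
    have mono: "(arcs_ends C)\<^sup>s \<subseteq> ?E" by (auto simp: symcl_def arcs_ends_conv H ends)
    have old: "(u, v) \<in> rtrancl_on (verts H) ?E" if "u \<in> verts C" "v \<in> verts C" for u v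
      using rtrancl_on_mono[OF mono, of "verts C" "verts H"] con that by (auto simp: connected_conv H)
    have new: "(tail G a, head G a) \<in> ?E" "(head G a, tail G a) \<in> ?E"
      by (auto simp: symcl_def arcs_ends_conv H)
    have to: "(u, tail G a) \<in> rtrancl_on (verts H) ?E" if "u \<in> verts H" for u
    proof (cases "u \<in> verts C")
      case False
      then have "u = head G a" using that by (simp add: H)
      then show ?thesis
        using converse_rtrancl_on_into_rtrancl_on[OF new(2) old[OF a(2) a(2)]] by (simp add: H)
    qed (use old a(2) in blast)
    have "sym ?E" by (auto simp: symcl_def sym_def)
    then have "(tail G a, u) \<in> rtrancl_on (verts H) ?E" if "u \<in> verts H" for u
      using to[OF that] rtrancl_on_sym by (metis symD)
    then have "(u, v) \<in> rtrancl_on (verts H) ?E" if "u \<in> verts H" "v \<in> verts H" for u v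
      using rtrancl_on_trans to that by metis
    then show ?thesis by (auto simp: connected_conv H)
  qed
  ultimately have "H = C" by (rule max)
  then show ?thesis using H(2) by auto
qed

lemma circular_part_simps [simp]:
  "verts (circular_part G r) = (\<Union>C\<in>{C \<in> components G. circular C r}. verts C)"
  "arcs (circular_part G r) = (\<Union>C\<in>{C \<in> components G. circular C r}. arcs C)"
  "tail (circular_part G r) = tail G"
  "head (circular_part G r) = head G"
  by (simp_all add: circular_part_def pre_digraph.Union_def)

lemma component_subgraph: "C \<in> components G \<Longrightarrow> subgraph C G"
  by (simp add: components_def pre_digraph.max_subgraph_def)

lemma subgraph_circular_part:
  assumes G: "wf_digraph G"
  shows "subgraph (circular_part G r) G"
proof -
  interpret G: wf_digraph G by (rule G)
  have ends: "tail C = tail G" "head C = head G" "wf_digraph C" "verts C \<subseteq> verts G" "arcs C \<subseteq> arcs G"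
    if "C \<in> components G" for C
    using component_subgraph[OF that] by (auto simp: subgraph_def compatible_def)
  have "wf_digraph (circular_part G r)"
  proof
    fix a assume "a \<in> arcs (circular_part G r)"
    then obtain C where C: "C \<in> components G" "circular C r" "a \<in> arcs C" by auto
    have "tail C a \<in> verts C" "head C a \<in> verts C"
      using wf_digraph.tail_in_verts[OF ends(3)[OF C(1)] C(3)] wf_digraph.head_in_verts[OF ends(3)[OF C(1)] C(3)]
      by simp_all
    then show "tail (circular_part G r) a \<in> verts (circular_part G r)"
      "head (circular_part G r) a \<in> verts (circular_part G r)"
      using C(1,2) ends(1,2)[OF C(1)] by auto
  qed
  moreover have "verts (circular_part G r) \<subseteq> verts G" "arcs (circular_part G r) \<subseteq> arcs G"
    using ends(4,5) by (simp_all add: UN_subset_iff)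
  ultimately show ?thesis using G by (simp add: subgraph_def compatible_def)
qed

text \<open>
  A circular component is open in \<open>G\<close>, so the valence two of the circle is the valence in all of \<open>G\<close>.
\<close>

lemma circular_part_out_arcs:
  assumes G: "wf_digraph G" and v: "v \<in> verts (circular_part G r)"
  shows "out_arcs (circular_part G r) v = out_arcs G v" and "card (out_arcs G v) = 2"
proof -
  obtain C where C: "C \<in> components G" "circular C r" "v \<in> verts C" using v by auto
  have sub: "subgraph C G" by (rule component_subgraph[OF C(1)])
  have out: "out_arcs G v = out_arcs C v"
    using component_closed[OF G C(1)] C(3) sub by (auto simp: out_arcs_def subgraph_def compatible_def)
  have "wf_digraph C" using sub by (simp add: subgraph_def)
  from circular_out_degree[OF this C(2,3)] show "card (out_arcs G v) = 2" by (simp add: out)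
  have "out_arcs C v \<subseteq> out_arcs (circular_part G r) v"
    using C sub by (auto simp: out_arcs_def subgraph_def compatible_def)
  moreover have "out_arcs (circular_part G r) v \<subseteq> out_arcs G v"
    using subgraph_circular_part[OF G, of r] by (auto simp: out_arcs_def subgraph_def)
  ultimately show "out_arcs (circular_part G r) v = out_arcs G v" using out by blast
qed

lemma circular_part_rev:
  assumes G: "bidirected_digraph G r" and a: "a \<in> arcs (circular_part G r)"
  shows "r a \<in> arcs (circular_part G r)"
proof -
  interpret G: bidirected_digraph G r by (rule G)
  have sub: "subgraph (circular_part G r) G" by (rule subgraph_circular_part) unfold_locales
  have aG: "a \<in> arcs G" using sub a unfolding subgraph_def by blast
  interpret S: wf_digraph "circular_part G r" using sub by (simp add: subgraph_def)
  have "head G a \<in> verts (circular_part G r)" using S.head_in_verts[OF a] by simp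
  then have "out_arcs (circular_part G r) (head G a) = out_arcs G (head G a)"
    by (intro circular_part_out_arcs(1)) unfold_locales
  moreover have "r a \<in> out_arcs G (head G a)" using aG by simp
  ultimately show ?thesis by (metis in_out_arcs_conv)
qed

lemma graph_morphism_subgraph:
  assumes "graph_morphism G r H t f" "subgraph S G"
  shows "graph_morphism S r H t f"
  using assms by (auto simp: graph_morphism_def subgraph_def compatible_def)

lemma immersion_subgraph:
  assumes "immersion G r H t f" "subgraph S G"
  shows "immersion S r H t f"
  unfolding immersion_def
proof (intro conjI ballI)
  show "graph_morphism S r H t f"
    using assms graph_morphism_subgraph by (auto simp: immersion_def)
  fix v assume "v \<in> verts S"
  then have "inj_on (amap f) (out_arcs G v)" using assms by (auto simp: immersion_def subgraph_def)
  then show "inj_on (amap f) (out_arcs S v)"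
    by (rule inj_on_subset) (use assms(2) in \<open>auto simp: subgraph_def compatible_def\<close>)
qed

lemma stacking_subgraph:
  assumes "stacking G f h" "subgraph S G"
  shows "stacking S f h"
proof -
  have sub: "verts S \<subseteq> verts G" "arcs S \<subseteq> arcs G" "tail S = tail G" "head S = head G"
    using assms(2) by (auto simp: subgraph_def compatible_def)
  then show ?thesis using assms(1) inj_on_subset[OF _ sub(1)]
    unfolding stacking_def sub(3,4) by blast
qed

lemma fibre_product_simps [simp]:
  "verts (fibre_product G f H g) = {(x, y). x \<in> verts G \<and> y \<in> verts H \<and> vmap f x = vmap g y}"
  "arcs (fibre_product G f H g) = {(a, b). a \<in> arcs G \<and> b \<in> arcs H \<and> amap f a = amap g b}"
  "tail (fibre_product G f H g) = map_prod (tail G) (tail H)"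
  "head (fibre_product G f H g) = map_prod (head G) (head H)"
  by (simp_all add: fibre_product_def)

lemma proj_simps [simp]: "vmap proj1 = fst" "amap proj1 = fst" "vmap proj2 = snd" "amap proj2 = snd"
  by (simp_all add: proj1_def proj2_def)

lemma proj_morphism:
  "graph_morphism (fibre_product G f H g) (fibre_rev G r f H s g) G r proj1"
  "graph_morphism (fibre_product G f H g) (fibre_rev G r f H s g) H s proj2"
  by (auto simp: graph_morphism_def fibre_rev_def)

lemma proj1_immersion:
  assumes "immersion H s K t g"
  shows "immersion (fibre_product G f H g) (fibre_rev G r f H s g) G r proj1"
  unfolding immersion_def
proof (intro conjI ballI proj_morphism)
  fix v assume v: "v \<in> verts (fibre_product G f H g)"
  then have inj: "inj_on (amap g) (out_arcs H (snd v))" using assms by (auto simp: immersion_def)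
  show "inj_on (amap proj1) (out_arcs (fibre_product G f H g) v)"
  proof (rule inj_onI)
    fix p q assume pq: "p \<in> out_arcs (fibre_product G f H g) v" "q \<in> out_arcs (fibre_product G f H g) v"
      "amap proj1 p = amap proj1 q"
    then have "amap g (snd p) = amap g (snd q)" "snd p \<in> out_arcs H (snd v)" "snd q \<in> out_arcs H (snd v)"
      by auto
    then have "snd p = snd q" by (rule inj_onD[OF inj])
    then show "p = q" using pq(3) by (simp add: prod_eq_iff)
  qed
qed

lemma proj2_inj_on_out_arcs:
  assumes "immersion G r K t f" "v \<in> verts (fibre_product G f H g)"
  shows "inj_on (amap proj2) (out_arcs (fibre_product G f H g) v)"
proof (rule inj_onI)
  have inj: "inj_on (amap f) (out_arcs G (fst v))" using assms by (auto simp: immersion_def)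
  fix p q assume pq: "p \<in> out_arcs (fibre_product G f H g) v" "q \<in> out_arcs (fibre_product G f H g) v"
    "amap proj2 p = amap proj2 q"
  then have "amap f (fst p) = amap f (fst q)" "fst p \<in> out_arcs G (fst v)" "fst q \<in> out_arcs G (fst v)"
    by auto
  then have "fst p = fst q" by (rule inj_onD[OF inj])
  then show "p = q" using pq(3) by (simp add: prod_eq_iff)
qed

text \<open>
  Two points of the fibre product with the same first coordinate have second coordinates with the
  same image under \<open>g\<close>, so they can be compared by \<open>h\<close>.
\<close>

lemma pullback_stacking:
  assumes "stacking H g h"
  shows "stacking (fibre_product G f H g) proj1 (h \<circ> vmap proj2)"
  unfolding stacking_def
proof (intro conjI ballI impI)
  have inj: "inj_on (\<lambda>v. (vmap g v, h v)) (verts H)" using assms by (simp add: stacking_def)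
  show "inj_on (\<lambda>v. (vmap proj1 v, (h \<circ> vmap proj2) v)) (verts (fibre_product G f H g))"
  proof (rule inj_onI)
    fix u v assume uv: "u \<in> verts (fibre_product G f H g)" "v \<in> verts (fibre_product G f H g)"
      "(vmap proj1 u, (h \<circ> vmap proj2) u) = (vmap proj1 v, (h \<circ> vmap proj2) v)"
    then have "(vmap g (snd u), h (snd u)) = (vmap g (snd v), h (snd v))" "snd u \<in> verts H" "snd v \<in> verts H"
      by auto
    then have "snd u = snd v" by (rule inj_onD[OF inj])
    then show "u = v" using uv(3) by (simp add: prod_eq_iff)
  qed
  fix a b assume "a \<in> arcs (fibre_product G f H g)" "b \<in> arcs (fibre_product G f H g)"
    "amap proj1 a = amap proj1 b"
  then have "snd a \<in> arcs H" "snd b \<in> arcs H" "amap g (snd a) = amap g (snd b)" by auto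
  then show "(h \<circ> vmap proj2) (tail (fibre_product G f H g) a) < (h \<circ> vmap proj2) (tail (fibre_product G f H g) b) \<longleftrightarrow>
      (h \<circ> vmap proj2) (head (fibre_product G f H g) a) < (h \<circ> vmap proj2) (head (fibre_product G f H g) b)"
    using assms by (simp add: stacking_def)
qed

lemma connected_no_isolated:
  assumes G: "bidirected_digraph G r" and con: "connected G" and a: "a \<in> arcs G" and v: "v \<in> verts G"
  shows "\<exists>b\<in>arcs G. tail G b = v"
proof -
  interpret G: bidirected_digraph G r by (rule G)
  have "(v, tail G a) \<in> rtrancl_on (verts G) ((arcs_ends G)\<^sup>s)" using con v a by (simp add: connected_conv)
  then show ?thesis
  proof (cases rule: converse_rtrancl_on_cases)
    case base
    then show ?thesis using a by auto
  next
    case (step c)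
    then obtain b where b: "b \<in> arcs G" "tail G b = v \<or> head G b = v"
      by (auto simp: symcl_def arcs_ends_conv)
    then show ?thesis using G.tail_arev[OF b(1)] G.arev_in_arcs[OF b(1)] by metis
  qed
qed

section \<open>The degree bound\<close>

theorem theorem2:
  fixes \<Gamma> :: "('v,'e) pre_digraph" and r :: "'e \<Rightarrow> 'e"
    and \<Gamma>' :: "('w,'d) pre_digraph" and r' :: "'d \<Rightarrow> 'd"
    and \<rho> :: "('w,'d,'v,'e) graph_map"
    and n :: nat and \<Lambda> :: "(nat, nat \<times> bool, 'v, 'e) graph_map"
    and \<S> :: "('w \<times> nat, 'd \<times> (nat \<times> bool)) pre_digraph"
    and s :: "'d \<times> (nat \<times> bool) \<Rightarrow> 'd \<times> (nat \<times> bool)"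
  assumes "core_graph \<Gamma> r" and "core_graph \<Gamma>' r'"
    and "immersion \<Gamma>' r' \<Gamma> r \<rho>"
    and "n \<ge> 1" and "primitive_loop n \<Gamma> r \<Lambda>"
    and "s = fibre_rev \<Gamma>' r' \<rho> (cycle_graph n) (cycle_rev n) \<Lambda>"
    and "\<S> = circular_part (fibre_product \<Gamma>' \<rho> (cycle_graph n) \<Lambda>) s"
    and "verts \<S> \<noteq> {}"
  shows "int (covering_degree \<S> (cycle_graph n) proj2) \<le> - euler_char \<Gamma>' r' \<or>
         reducible \<S> s \<Gamma>' r' proj1"
proof -
  let ?C = "cycle_graph n"
  define P where "P = fibre_product \<Gamma>' \<rho> ?C \<Lambda>"
  have \<Gamma>: "bidirected_digraph \<Gamma> r" and \<Gamma>': "bidirected_digraph \<Gamma>' r'" "fin_digraph \<Gamma>'" "connected \<Gamma>'"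
    using assms(1,2) by (simp_all add: core_graph_def)
  interpret \<Gamma>': fin_digraph \<Gamma>' by (rule \<Gamma>'(2))
  have \<Lambda>: "immersion ?C (cycle_rev n) \<Gamma> r \<Lambda>" using assms(5) by (simp add: primitive_loop_def)
  obtain h where h: "stacking ?C \<Lambda> h" using primitive_loop_has_stacking[OF \<Gamma> assms(4,5)] by blast
  have P: "bidirected_digraph P s"
    unfolding P_def assms(6)
    using \<Gamma>'(1) bidirected_cycle_graph[OF assms(4)] assms(3) \<Lambda>
    by (intro bidirected_fibre_product) (auto simp: immersion_def)
  interpret P: bidirected_digraph P s by (rule P)
  have \<S>: "\<S> = circular_part P s" by (simp add: assms(7) P_def)
  have sub: "subgraph \<S> P" unfolding \<S> by (rule subgraph_circular_part) unfold_locales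
  have ends: "tail \<S> = tail P" "head \<S> = head P" "verts \<S> \<subseteq> verts P" "arcs \<S> \<subseteq> arcs P"
    using sub by (auto simp: subgraph_def compatible_def)
  have out: "out_arcs \<S> v = out_arcs P v" "card (out_arcs P v) = 2" if "v \<in> verts \<S>" for v
    using circular_part_out_arcs[OF P.wf_digraph_axioms] that unfolding \<S> by blast+
  have fin: "finite (verts \<S>)"
  proof (rule finite_subset)
    show "verts \<S> \<subseteq> verts \<Gamma>' \<times> {..<n}" using ends(3) by (auto simp: P_def)
  qed simp
  have mor: "graph_morphism \<S> s ?C (cycle_rev n) proj2"
    by (rule graph_morphism_subgraph[OF _ sub]) (simp add: P_def assms(6) proj_morphism)
  have covers: "bij_betw (amap proj2) (out_arcs \<S> v) (out_arcs ?C (vmap proj2 v))" if v: "v \<in> verts \<S>" for v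
  proof -
    have inj: "inj_on (amap proj2) (out_arcs \<S> v)"
      using proj2_inj_on_out_arcs[OF assms(3)] ends(3) v unfolding out(1)[OF v] P_def by blast
    have sub_out: "amap proj2 ` out_arcs \<S> v \<subseteq> out_arcs ?C (vmap proj2 v)"
      using mor by (force simp: graph_morphism_def)
    have "vmap proj2 v < n" using mor v by (simp add: graph_morphism_def)
    then have two: "finite (out_arcs ?C (vmap proj2 v))" "card (out_arcs ?C (vmap proj2 v)) = 2"
      by (simp_all add: out_arcs_cycle_graph)
    have "card (amap proj2 ` out_arcs \<S> v) = 2" using card_image[OF inj] out[OF v] by simp
    then have "amap proj2 ` out_arcs \<S> v = out_arcs ?C (vmap proj2 v)"
      using card_subset_eq[OF two(1) sub_out] two(2) by simp
    then show ?thesis using inj by (simp add: bij_betw_def)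
  qed
  obtain v where v: "v \<in> verts \<S>" using assms(8) by blast
  have "out_arcs P v \<noteq> {}" using out(2)[OF v] by auto
  then obtain a where "a \<in> arcs P" by auto
  then have a: "fst a \<in> arcs \<Gamma>'" by (auto simp: P_def)
  have "stacked_cover \<Gamma>' r' \<S> s proj1 n proj2 h"
  proof (rule stacked_cover.intro)
    show "wf_digraph \<S>" using sub by (simp add: subgraph_def)
    show "immersion \<S> s \<Gamma>' r' proj1"
      by (rule immersion_subgraph[OF _ sub]) (use proj1_immersion[OF \<Lambda>] in \<open>simp add: P_def assms(6)\<close>)
    show "stacking \<S> proj1 (h \<circ> vmap proj2)"
      by (rule stacking_subgraph[OF _ sub]) (use pullback_stacking[OF h] in \<open>simp add: P_def\<close>)
    show "\<exists>b\<in>arcs \<Gamma>'. tail \<Gamma>' b = x" if "x \<in> verts \<Gamma>'" for x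
      by (rule connected_no_isolated[OF \<Gamma>'(1,3) a that])
    fix b assume b: "b \<in> arcs \<S>"
    then have "b \<in> arcs P" using ends(4) by blast
    then show "s (s b) = b" "tail \<S> (s b) = head \<S> b" by (simp_all add: ends)
    show "s b \<in> arcs \<S>" using circular_part_rev[OF P] b unfolding \<S> by blast
  qed (fact \<Gamma>' fin mor covers assms(4))+
  then show ?thesis using stacked_cover.degree_le by blast
qed

end
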